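(* Fix an integer $r\ge3$ and let $c_r=\frac{r}{r-1}$. For $x\ge0$ define $$\Phi_n(x)=\begin{cases} n,& x=0,\\ \dfrac{\log(1+nx)}{\log(1+x)},& x>0.\end{cases}$$ For every $n$ and every $d\ge c_r$, let $\gamma=(r-1)d-r$. Then $t_r(n,d,c_r)=\Theta_r(\Phi_n(\gamma))$; that is, there are constants $b_r,B_r>0$ depending only on $r$ such that $b_r\Phi_n(\gamma)\le t_r(n,d,c_r)\le B_r\Phi_n(\gamma)$ for all such $n$ and $d$. Moreover, $t_r(n,c_r,c_r)=n$ whenever $(r-1)\mid n$.
   Context: An $r$-graph ($r$-uniform hypergraph) is a pair $H=(V(H),E(H))$ with $V(H)$ a finite set and $E(H)\subseteq\binom{V(H)}{r}$; $e(H)=|E(H)|$. An $r$-graph $F$ is a subhypergraph of $H$ if $V(F)\subseteq V(H)$ and $E(F)\subseteq E(H)$. The average degree of an $r$-graph $H$ with nonempty vertex set is $\overline d(H)=r\,e(H)/|V(H)|$. For real numbers $d\ge s>1$, $t_r(n,d,s)$ denotes the smallest integer $t$ such that every $n$-vertex $r$-graph $H$ with $\overline d(H)\ge d$ contains a nonempty subhypergraph $H'$ with $|V(H')|\le t$ and $\overline d(H')\ge s$. It is considered only for pairs $(n,d)$ for which at least one $n$-vertex $r$-graph of average degree at least $d$ exists, i.e. $d\le\binom{n-1}{r-1}$ (in particular, for $d\ge c_r$ this forces $n\ge r+1$). *)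

theory Defs
  imports Complex_Main
begin

type_synonym 'a hypergraph = "'a set \<times> 'a set set"

abbreviation verts :: "'a hypergraph \<Rightarrow> 'a set" where
  "verts H \<equiv> fst H"

abbreviation edges :: "'a hypergraph \<Rightarrow> 'a set set" where
  "edges H \<equiv> snd H"

definition rgraph :: "nat \<Rightarrow> 'a hypergraph \<Rightarrow> bool" where
  "rgraph r H \<longleftrightarrow> finite (verts H) \<and> edges H \<subseteq> {e. e \<subseteq> verts H \<and> card e = r}"

definition subhypergraph :: "'a hypergraph \<Rightarrow> 'a hypergraph \<Rightarrow> bool" where
  "subhypergraph F H \<longleftrightarrow> verts F \<subseteq> verts H \<and> edges F \<subseteq> edges H"

text \<open>Only meaningful for a nonempty vertex set; with an empty one it takes the value 0.\<close>

definition avg_degree :: "nat \<Rightarrow> 'a hypergraph \<Rightarrow> real" where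
  "avg_degree r H = real r * real (card (edges H)) / real (card (verts H))"

text \<open>
  An \<open>n\<close>-vertex \<open>r\<close>-graph is isomorphic to one whose vertices are natural numbers, so
  quantifying over hypergraphs on finite subsets of \<^typ>\<open>nat\<close> covers all of them.
\<close>

definition dense_rgraph :: "nat \<Rightarrow> nat \<Rightarrow> real \<Rightarrow> nat hypergraph \<Rightarrow> bool" where
  "dense_rgraph r n d H \<longleftrightarrow>
     rgraph r H \<and> verts H \<noteq> {} \<and> card (verts H) = n \<and> avg_degree r H \<ge> d"

definition admissible :: "nat \<Rightarrow> nat \<Rightarrow> real \<Rightarrow> bool" where
  "admissible r n d \<longleftrightarrow> (\<exists>H. dense_rgraph r n d H)"

text \<open>
  If \<open>admissible r n d\<close> and \<open>s \<le> d\<close>, the set over which the minimum is taken contains \<open>n\<close>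
  (take \<open>H' = H\<close>) and every integer in it is positive, so a minimum over \<^typ>\<open>nat\<close> is the
  minimum over the integers.
\<close>

definition t_min :: "nat \<Rightarrow> nat \<Rightarrow> real \<Rightarrow> real \<Rightarrow> nat" where
  "t_min r n d s =
     (LEAST t. \<forall>H. dense_rgraph r n d H \<longrightarrow>
        (\<exists>H'. rgraph r H' \<and> subhypergraph H' H \<and> verts H' \<noteq> {} \<and>
              card (verts H') \<le> t \<and> avg_degree r H' \<ge> s))"

definition c_crit :: "nat \<Rightarrow> real" where
  "c_crit r = real r / (real r - 1)"

definition Phi :: "nat \<Rightarrow> real \<Rightarrow> real" where
  "Phi n x = (if x = 0 then real n else ln (1 + real n * x) / ln (1 + x))"

lemma admissible_iff:
  assumes "d > 0" "r \<ge> 2"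
  shows "admissible r n d \<longleftrightarrow> d \<le> real ((n - 1) choose (r - 1))"
proof -
  have key: "real r * real (n choose r) / real n = real ((n - 1) choose (r - 1))" if "n > 0"
  proof -
    have "r * (n choose r) = n * ((n - 1) choose (r - 1))"
      using times_binomial_minus1_eq[of r n] assms(2) by simp
    then have "real r * real (n choose r) = real n * real ((n - 1) choose (r - 1))"
      by (metis of_nat_mult)
    then show ?thesis using that by (simp add: field_simps)
  qed
  show ?thesis
  proof
    assume "admissible r n d"
    then obtain H :: "nat hypergraph" where H: "rgraph r H" "verts H \<noteq> {}" "card (verts H) = n"
        "avg_degree r H \<ge> d"
      unfolding admissible_def dense_rgraph_def by blast
    have fin: "finite (verts H)" and sub: "edges H \<subseteq> {e. e \<subseteq> verts H \<and> card e = r}"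
      using H(1) unfolding rgraph_def by auto
    have n: "n > 0" using H(2,3) fin by (metis card_gt_0_iff)
    have "card (edges H) \<le> card {e. e \<subseteq> verts H \<and> card e = r}"
      by (rule card_mono[OF _ sub]) (use fin in simp)
    also have "\<dots> = n choose r" using n_subsets[OF fin, of r] H(3) by simp
    finally have "real r * real (card (edges H)) / real n \<le> real r * real (n choose r) / real n"
      by (intro divide_right_mono mult_left_mono) auto
    then show "d \<le> real ((n - 1) choose (r - 1))"
      using H(4) key[OF n] unfolding avg_degree_def H(3) by linarith
  next
    assume d: "d \<le> real ((n - 1) choose (r - 1))"
    show "admissible r n d"
    proof (cases "n = 0")
      case True
      then show ?thesis using d assms by (simp add: binomial_eq_0)
    next
      case False
      let ?H = "({..<n}, {e. e \<subseteq> {..<n} \<and> card e = r})"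
      have "card (edges ?H) = n choose r" using n_subsets[of "{..<n}" r] by simp
      then have "dense_rgraph r n d ?H"
        using d key False unfolding dense_rgraph_def rgraph_def avg_degree_def by auto
      then show ?thesis unfolding admissible_def by blast
    qed
  qed
qed

end

theory Submission
  imports Defs
begin

text \<open>
  A subhypergraph has average degree at least \<open>c_crit r\<close> iff its order is at most \<open>r - 1\<close> times
  its number of edges, whereas a connected hypergraph with \<open>e\<close> edges has at most
  \<open>1 + (r - 1) e\<close> vertices; so one is looking for a short cycle.

  Upper bound: put \<open>x = \<gamma> / r\<close>, so that \<open>(1 + x) n \<le> (r - 1) e\<close>, and pass to a subgraph of minimum
  order with this density. There every vertex set \<open>S\<close> meets at least \<open>(1 + x) |S| / (r - 1)\<close> edges.
  As long as the ball of radius \<open>k\<close> around a vertex is a tree, its order is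
  therefore at least \<open>((1 + x)^(k+1) - 1) / x\<close>. This is at most \<open>n\<close> only
  for \<open>k + 1 \<le> Phi n x\<close>, and \<open>Phi n x \<le> r Phi n \<gamma>\<close>.

  Lower bound: for \<open>\<gamma>\<close> bounded away from \<open>0\<close>, add edges greedily between far apart vertices of
  small degree. For small \<open>\<gamma>\<close>, start from such a graph (uniformity \<open>2\<close>, bounded degree) on about
  \<open>\<gamma> n\<close> vertices, subdivide its edges into paths of length about \<open>1 / \<gamma>\<close>, and add \<open>r - 2\<close> private
  vertices to every edge; both operations preserve the excess \<open>(r - 1) e - n\<close>.
\<close>

section \<open>Connected edge sets and breadth-first search\<close>

text \<open>The hypergraph form of large girth: no nonempty set of at most \<open>g\<close> edges
  reaches the critical density on its own vertices. For \<open>r = 2\<close> and edges of size 2,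
  every cycle has more than \<open>g\<close> edges.\<close>

definition sparse :: "nat \<Rightarrow> nat \<Rightarrow> 'a set set \<Rightarrow> bool" where
  "sparse r g E \<longleftrightarrow>
     (\<forall>F\<subseteq>E. F \<noteq> {} \<and> card F \<le> g \<longrightarrow> (r - 1) * card F < card (\<Union>F))"

lemma sparseD:
  "sparse r g E \<Longrightarrow> F \<subseteq> E \<Longrightarrow> F \<noteq> {} \<Longrightarrow> card F \<le> g \<Longrightarrow> (r - 1) * card F < card (\<Union>F)"
  unfolding sparse_def by blast

lemma sparse_subset: "sparse r g E \<Longrightarrow> E' \<subseteq> E \<Longrightarrow> sparse r g E'"
  unfolding sparse_def by blast

text \<open>Connectedness as a construction order: each edge meets what is already reached, and the
  root \<open>x\<close> counts as reached from the start. Bounds on order and radius follow by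
  induction; an edge may be repeated, hence the case split \<open>e \<in> C\<close> there.\<close>

inductive conn :: "'a \<Rightarrow> 'a set set \<Rightarrow> bool" for x where
  conn_empty: "conn x {}"
| conn_insert: "conn x C \<Longrightarrow> e \<inter> insert x (\<Union>C) \<noteq> {} \<Longrightarrow> conn x (insert e C)"

lemma conn_finite: "conn x C \<Longrightarrow> finite C"
  by (induction rule: conn.induct) auto

lemma conn_Un:
  assumes "conn x D" "conn x C" shows "conn x (C \<union> D)"
  using assms
proof (induction rule: conn.induct)
  case (conn_insert D e)
  have "conn x (insert e (C \<union> D))"
    by (rule conn.conn_insert) (use conn_insert in auto)
  then show ?case by simp
qed simp

text \<open>Each added edge shares a vertex with the part already built, so it brings at most
  \<open>r - 1\<close> new ones.\<close>

lemma conn_card_le: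
  assumes "conn x C" "\<And>e. e \<in> C \<Longrightarrow> finite e \<and> card e = r"
  shows "card (insert x (\<Union>C)) \<le> 1 + (r - 1) * card C"
  using assms
proof (induction rule: conn.induct)
  case (conn_insert C e)
  have IH: "card (insert x (\<Union>C)) \<le> 1 + (r - 1) * card C"
    by (rule conn_insert.IH) (rule conn_insert.prems, simp)
  show ?case
  proof (cases "e \<in> C")
    case True
    then have "insert e C = C" by blast
    then show ?thesis using IH by (simp only:)
  next
    case False
    let ?B = "insert x (\<Union>C)"
    have fC: "finite C" by (rule conn_finite[OF conn_insert.hyps(1)])
    have fin: "finite e'" if "e' \<in> insert e C" for e'
      using conn_insert.prems[OF that] by simp
    have fB: "finite ?B" using fC fin by simp
    have e: "finite e" "card e = r" using conn_insert.prems[of e] by simp_all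
    obtain u where u: "u \<in> e" "u \<in> ?B" using conn_insert.hyps(2) by blast
    have "insert x (\<Union>(insert e C)) \<subseteq> ?B \<union> (e - {u})" using u by auto
    then have "card (insert x (\<Union>(insert e C))) \<le> card (?B \<union> (e - {u}))"
      by (rule card_mono[rotated]) (use fB e in auto)
    also have "\<dots> \<le> card ?B + card (e - {u})" by (rule card_Un_le)
    also have "card (e - {u}) = r - 1" using u e by simp
    also have "card ?B \<le> 1 + (r - 1) * card C" by (fact IH)
    finally show ?thesis using False fC by simp
  qed
qed simp

primrec bfs_edges :: "'a set set \<Rightarrow> 'a \<Rightarrow> nat \<Rightarrow> 'a set set" where
  "bfs_edges E x 0 = {}"
| "bfs_edges E x (Suc k) = {e \<in> E. e \<inter> insert x (\<Union>(bfs_edges E x k)) \<noteq> {}}"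

abbreviation bfs_ball :: "'a set set \<Rightarrow> 'a \<Rightarrow> nat \<Rightarrow> 'a set" where
  "bfs_ball E x k \<equiv> insert x (\<Union>(bfs_edges E x k))"

lemma bfs_edges_subset: "bfs_edges E x k \<subseteq> E"
  by (cases k) auto

lemma bfs_edges_Suc_mono: "bfs_edges E x k \<subseteq> bfs_edges E x (Suc k)"
proof (induction k)
  case (Suc k)
  then have "bfs_ball E x k \<subseteq> bfs_ball E x (Suc k)" by blast
  then show ?case unfolding bfs_edges.simps(2)[of E x "Suc k"] bfs_edges.simps(2)[of E x k] by blast
qed simp

lemma bfs_edges_mono: "j \<le> k \<Longrightarrow> bfs_edges E x j \<subseteq> bfs_edges E x k"
  using bfs_edges_Suc_mono by (metis lift_Suc_mono_le)

lemma conn_subset_ball: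
  assumes "conn x C" "C \<subseteq> E"
  shows "insert x (\<Union>C) \<subseteq> bfs_ball E x (card C)"
  using assms
proof (induction rule: conn.induct)
  case (conn_insert C e)
  show ?case
  proof (cases "e \<in> C")
    case True
    then have "insert e C = C" by blast
    then show ?thesis using conn_insert.IH conn_insert.prems by metis
  next
    case False
    have IH: "insert x (\<Union>C) \<subseteq> bfs_ball E x (card C)" using conn_insert by auto
    have c: "card (insert e C) = Suc (card C)"
      using False conn_finite[OF conn_insert.hyps(1)] by simp
    have "e \<in> bfs_edges E x (Suc (card C))"
      using IH conn_insert.hyps(2) conn_insert.prems by auto
    then have "e \<subseteq> bfs_ball E x (Suc (card C))" by blast
    moreover have "bfs_ball E x (card C) \<subseteq> bfs_ball E x (Suc (card C))"
      using bfs_edges_Suc_mono[of E x "card C"] by blast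
    ultimately show ?thesis unfolding c using IH by blast
  qed
qed simp

text \<open>Walking back to the root costs one edge per layer; this keeps the cycles found in the
  breadth-first search short.\<close>

lemma ball_conn:
  assumes "y \<in> bfs_ball E x k"
  obtains C where "C \<subseteq> bfs_edges E x k" "conn x C" "card C \<le> k" "y \<in> insert x (\<Union>C)"
  using assms
proof (induction k arbitrary: y thesis)
  case 0
  then show ?case using conn_empty[of x] by (metis bfs_edges.simps(1) card.empty order_refl)
next
  case (Suc k)
  show ?case
  proof (cases "y = x")
    case True
    then show ?thesis using Suc.prems(1)[of "{}"] conn_empty[of x] by simp
  next
    case False
    then obtain e where e: "e \<in> bfs_edges E x (Suc k)" "y \<in> e" using Suc.prems(2) by blast
    then obtain z where z: "z \<in> e" "z \<in> bfs_ball E x k" by auto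
    obtain C where C: "C \<subseteq> bfs_edges E x k" "conn x C" "card C \<le> k" "z \<in> insert x (\<Union>C)"
      using Suc.IH[OF _ z(2)] by blast
    show ?thesis
    proof (rule Suc.prems(1))
      show "insert e C \<subseteq> bfs_edges E x (Suc k)"
        using C(1) e(1) bfs_edges_Suc_mono[of E x k] by blast
      show "conn x (insert e C)" by (rule conn_insert) (use C z in auto)
      show "card (insert e C) \<le> Suc k"
        using C(3) conn_finite[OF C(2)] by (simp add: card_insert_if)
      show "y \<in> insert x (\<Union>(insert e C))" using e by auto
    qed
  qed
qed

text \<open>A new edge meeting the ball in two vertices closes a cycle through the root with at
  most \<open>2 k + 2\<close> edges.\<close>

lemma bfs_ball_tree:
  assumes fin: "finite E" and unif: "\<And>e. e \<in> E \<Longrightarrow> finite e \<and> card e = r"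
    and r: "r \<ge> 2" and sp: "sparse r (2 * m) E" and "k \<le> m"
  shows "1 + (r - 1) * card (bfs_edges E x k) \<le> card (bfs_ball E x k)"
  using \<open>k \<le> m\<close>
proof (induction k)
  case (Suc k)
  let ?B = "bfs_ball E x k"
  have finB: "finite (bfs_edges E x j)" for j
    using bfs_edges_subset fin finite_subset by metis
  have finBall: "finite ?B" using finB[of k] bfs_edges_subset[of E x k] unif by blast
  have step: "card (?B \<union> \<Union>M) \<ge> card ?B + (r - 1) * card M"
    if "finite M" "M \<subseteq> bfs_edges E x (Suc k) - bfs_edges E x k" for M
    using that
  proof (induction M)
    case (insert f M)
    have ME: "M \<subseteq> E" "f \<in> E" "bfs_edges E x k \<subseteq> E"
      using insert.prems bfs_edges_subset[of E x k] by auto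
    have f: "finite f" "card f = r" using unif ME by auto
    have fM: "finite (?B \<union> \<Union>M)" using finBall insert.hyps unif ME by auto
    obtain u where u: "u \<in> f" "u \<in> ?B" using insert.prems by auto
    \<comment> \<open>The new edge \<open>f\<close> meets the ball in \<open>u\<close>. A second
      vertex \<open>w\<close> shared with the ball or with the edges added before closes a
      cycle.\<close>
    have one: "f \<inter> (?B \<union> \<Union>M) \<subseteq> {u}"
    proof
      fix w assume w: "w \<in> f \<inter> (?B \<union> \<Union>M)"
      show "w \<in> {u}"
      proof (rule ccontr)
        assume wu: "w \<notin> {u}"
        obtain C where C: "C \<subseteq> bfs_edges E x k" "conn x C" "card C \<le> k" "u \<in> insert x (\<Union>C)"
          using ball_conn[OF u(2)] by blast
        \<comment> \<open>If \<open>w\<close> lies outside the ball, it is on another edge of the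
          new layer; that edge accounts for \<open>Suc k\<close>.\<close>
        have "\<exists>C'. C' \<subseteq> bfs_edges E x k \<union> M \<and> conn x C' \<and> card C' \<le> Suc k
            \<and> w \<in> insert x (\<Union>C')"
        proof (cases "w \<in> ?B")
          case True
          then show ?thesis using ball_conn[OF True] by (metis le_SucI le_supI1)
        next
          case False
          then obtain e where e: "e \<in> M" "w \<in> e" using w by blast
          then obtain z where z: "z \<in> e" "z \<in> ?B" using insert.prems by auto
          obtain C' where C': "C' \<subseteq> bfs_edges E x k" "conn x C'" "card C' \<le> k"
              "z \<in> insert x (\<Union>C')"
            using ball_conn[OF z(2)] by blast
          have "conn x (insert e C')" by (rule conn_insert) (use C' z in auto)
          moreover have "card (insert e C') \<le> Suc k"
            using C'(3) conn_finite[OF C'(2)] by (simp add: card_insert_if)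
          ultimately show ?thesis using C'(1) e by (intro exI[of _ "insert e C'"]) auto
        qed
        then obtain C' where C': "C' \<subseteq> bfs_edges E x k \<union> M" "conn x C'" "card C' \<le> Suc k"
            "w \<in> insert x (\<Union>C')" by blast
        let ?D = "C \<union> C'"
        have D: "conn x ?D" using conn_Un[OF C'(2) C(2)] .
        have DE: "?D \<subseteq> E" using C(1) C'(1) ME by blast
        have fD: "f \<notin> ?D" using C(1) C'(1) insert.prems insert.hyps by blast
        have cD: "card ?D \<le> 2 * k + 1" using card_Un_le[of C C'] C(3) C'(3) by linarith
        have finD: "finite ?D" using conn_finite[OF D] .
        have cDf: "card (insert f ?D) = Suc (card ?D)" using finD fD by simp
        \<comment> \<open>Only \<open>f - {u, w}\<close> is new, so \<open>?D\<close> together with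
          \<open>f\<close> spans too few vertices. It has at most
          \<open>2 * k + 2 \<le> 2 * m\<close> edges, against sparsity.\<close>
        have "\<Union>(insert f ?D) \<subseteq> insert x (\<Union>?D) \<union> (f - {u, w})"
          using C(4) C'(4) by auto
        then have "card (\<Union>(insert f ?D)) \<le> card (insert x (\<Union>?D) \<union> (f - {u, w}))"
          by (rule card_mono[rotated]) (use finD unif DE f in auto)
        also have "\<dots> \<le> card (insert x (\<Union>?D)) + card (f - {u, w})" by (rule card_Un_le)
        also have "card (f - {u, w}) = r - 2"
          using u w wu f by (subst card_Diff_subset) auto
        also have "card (insert x (\<Union>?D)) \<le> 1 + (r - 1) * card ?D"
          using conn_card_le[OF D] unif DE by blast
        finally have "card (\<Union>(insert f ?D)) \<le> 1 + (r - 1) * card ?D + (r - 2)"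
            by simp
          then have "card (\<Union>(insert f ?D)) \<le> (r - 1) * card (insert f ?D)"
            unfolding cDf mult_Suc_right using r by linarith
        moreover have "(r - 1) * card (insert f ?D) < card (\<Union>(insert f ?D))"
        proof (rule sparseD[OF sp])
          show "insert f ?D \<subseteq> E" using DE ME by blast
          show "card (insert f ?D) \<le> 2 * m" unfolding cDf using cD Suc.prems by linarith
        qed simp
        ultimately show False by linarith
      qed
    qed
    have "card (f - {u}) = r - 1" using u f by simp
    moreover have "card ((?B \<union> \<Union>M) \<union> (f - {u})) = card (?B \<union> \<Union>M) + card (f - {u})"
      by (rule card_Un_disjoint) (use fM f one in auto)
    moreover have "(?B \<union> \<Union>M) \<union> (f - {u}) = ?B \<union> \<Union>(insert f M)" using u by auto
    moreover have "card ?B + (r - 1) * card M \<le> card (?B \<union> \<Union>M)" using insert by simp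
    ultimately show ?case using insert.hyps by simp
  qed simp
  let ?N = "bfs_edges E x (Suc k) - bfs_edges E x k"
  have c: "card (bfs_edges E x (Suc k)) = card (bfs_edges E x k) + card ?N"
    using bfs_edges_Suc_mono[of E x k] finB
    by (metis card_Diff_subset card_mono le_add_diff_inverse)
  have "?B \<union> \<Union>?N = bfs_ball E x (Suc k)" using bfs_edges_Suc_mono[of E x k] by blast
  then have "card (bfs_ball E x (Suc k)) \<ge> card ?B + (r - 1) * card ?N"
    using step[of ?N] finB[of "Suc k"] by (metis finite_Diff order_refl)
  moreover have "1 + (r - 1) * card (bfs_edges E x k) \<le> card ?B" using Suc by simp
  ultimately show ?case unfolding c by (simp only: distrib_left)
qed simp

section \<open>Minimal dense subgraphs\<close>

text \<open>Take a dense subgraph on as few vertices as possible: deleting \<open>S\<close> must then destroy the density.\<close>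

lemma dense_core:
  fixes c :: real
  assumes "finite V" "V \<noteq> {}" "E \<subseteq> Pow V" "c * card V \<le> real s * card E" "{} \<notin> E"
  obtains V' E' where "V' \<subseteq> V" "V' \<noteq> {}" "E' \<subseteq> E" "E' \<subseteq> Pow V'"
    "\<forall>S\<subseteq>V'. S \<noteq> {} \<longrightarrow> c * card S \<le> real s * card {e \<in> E'. e \<inter> S \<noteq> {}}"
proof -
  define P where "P V' \<longleftrightarrow> V' \<subseteq> V \<and> V' \<noteq> {} \<and>
    (\<exists>E'\<subseteq>E. E' \<subseteq> Pow V' \<and> c * card V' \<le> real s * card E')" for V'
  have "P V" unfolding P_def using assms by blast
  then obtain V' where V': "P V'" and min: "\<And>W. P W \<Longrightarrow> card V' \<le> card W"
    by (metis ex_has_least_nat)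
  obtain E' where E': "E' \<subseteq> E" "E' \<subseteq> Pow V'" "c * card V' \<le> real s * card E'"
    using V' unfolding P_def by blast
  have fV: "finite V'" using V' assms(1) finite_subset unfolding P_def by blast
  have fE: "finite E'" using fV E'(2) finite_subset by blast
  show ?thesis
  proof
    show "V' \<subseteq> V" "V' \<noteq> {}" using V' unfolding P_def by auto
    show "E' \<subseteq> E" "E' \<subseteq> Pow V'" by (fact E')+
    have "c * card S \<le> real s * card {e \<in> E'. e \<inter> S \<noteq> {}}"
      if S: "S \<subseteq> V'" "S \<noteq> {}" for S
    proof -
      let ?T = "{e \<in> E'. e \<inter> S \<noteq> {}}"
      have fS: "finite S" using S fV finite_subset by blast
      have cE: "real (card E') = card ?T + real (card (E' - ?T))"
        using card_Int_Diff[OF fE, of ?T] by (simp add: Int_absorb1)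
      have cV: "real (card V') = card S + real (card (V' - S))"
        using card_Int_Diff[OF fV, of S] S by (simp add: Int_absorb1)
      \<comment> \<open>Edges avoiding \<open>S\<close> live on \<open>V' - S\<close>, which by
        minimality is not dense enough. If \<open>S = V'\<close>, no edge avoids it because edges
        are nonempty. Subtracting from the density of \<open>V'\<close> gives the claim.\<close>
      have rest: "real s * card (E' - ?T) \<le> c * card (V' - S)"
      proof (cases "V' = S")
        case True
        have "e \<inter> S \<noteq> {}" if "e \<in> E'" for e
        proof -
          have "e \<noteq> {}" using that E'(1) assms(5) by auto
          then show ?thesis using that E'(2) True by auto
        qed
        then have "E' - ?T = {}" by blast
        then show ?thesis unfolding True by (simp only:) simp
      next
        case False
        have "card (V' - S) < card V'" by (rule psubset_card_mono[OF fV]) (use S in \<open>auto simp: psubset_eq\<close>)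
        then have "\<not> P (V' - S)" using min[of "V' - S"] by linarith
        moreover have "E' - ?T \<subseteq> Pow (V' - S)" using E'(2) by (auto simp: Pow_def)
        moreover have "V' - S \<subseteq> V" "V' - S \<noteq> {}" "E' - ?T \<subseteq> E"
          using V' False S E'(1) unfolding P_def by auto
        ultimately have "\<not> c * card (V' - S) \<le> real s * card (E' - ?T)"
          unfolding P_def by meson
        then show ?thesis by linarith
      qed
      show ?thesis
        using rest E'(3) unfolding cE cV distrib_left by linarith
    qed
    then show "\<forall>S\<subseteq>V'. S \<noteq> {} \<longrightarrow> c * card S \<le> real s * card {e \<in> E'. e \<inter> S \<noteq> {}}"
      by blast
  qed
qed

section \<open>Upper bound and transfer to the extremal function\<close>

lemma short_cycle:
  fixes x :: real and V :: "'a set"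
  assumes V: "finite V" "V \<noteq> {}" and E: "E \<subseteq> {e. e \<subseteq> V \<and> card e = r}" and r: "r \<ge> 2"
    and x: "x > 0" and dense: "(1 + x) * card V \<le> real (r - 1) * card E"
  obtains F where "F \<subseteq> E" "F \<noteq> {}" "card (\<Union>F) \<le> (r - 1) * card F"
    "real (card F) \<le> 2 * ln (1 + card V * x) / ln (1 + x)"
proof -
  have ne: "{} \<notin> E"
  proof
    assume "{} \<in> E"
    then have "card ({} :: 'a set) = r" using E by blast
    then show False using r by simp
  qed
  have EP: "E \<subseteq> Pow V" using E by auto
  obtain V' E' where V': "V' \<subseteq> V" "V' \<noteq> {}" and E': "E' \<subseteq> E" "E' \<subseteq> Pow V'"
    and core: "\<forall>S\<subseteq>V'. S \<noteq> {} \<longrightarrow>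
      (1 + x) * card S \<le> real (r - 1) * card {e \<in> E'. e \<inter> S \<noteq> {}}"
    by (rule dense_core[OF V EP dense ne])
  have fV': "finite V'" using V' V finite_subset by blast
  have fE': "finite E'" using E'(2) fV' finite_subset by blast
  have unif: "finite e \<and> card e = r" if "e \<in> E'" for e
    using that E' E finite_subset[OF _ fV', of e] by auto
  obtain v where v: "v \<in> V'" using V' by blast
  \<comment> \<open>The largest radius the growth allows: \<open>(1 + x)^(m + 1)\<close> exceeds
    \<open>1 + card V * x\<close>.\<close>
  define m where "m = nat \<lfloor>ln (1 + card V * x) / ln (1 + x)\<rfloor>"
  have lx: "ln (1 + x) > 0" using x by simp
  have "real m = of_int \<lfloor>ln (1 + card V * x) / ln (1 + x)\<rfloor>"
    unfolding m_def using x lx by simp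
  then have m: "real m \<le> ln (1 + card V * x) / ln (1 + x)" "ln (1 + card V * x) / ln (1 + x) < m + 1"
    by linarith+
  have "\<not> sparse r (2 * m) E'"
  proof
    assume sp: "sparse r (2 * m) E'"
    have ball: "bfs_ball E' v k \<subseteq> V'" for k
      using bfs_edges_subset[of E' v k] E'(2) v by blast
    have growth: "(1 + x) ^ (k + 1) - 1 \<le> x * card (bfs_ball E' v k)" if "k \<le> m" for k
      using that
    proof (induction k)
      case (Suc k)
      let ?b = "card (bfs_ball E' v k)"
      \<comment> \<open>The edges meeting a ball are exactly the next set \<open>bfs_edges\<close>,
        so the core property becomes the recursion \<open>b' \<ge> 1 + (1 + x) * b\<close> for the
        orders of consecutive balls.\<close>
      have "1 + (1 + x) * ?b \<le> 1 + real (r - 1) * card (bfs_edges E' v (Suc k))"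
        using core[rule_format, of "bfs_ball E' v k"] ball by simp
      also have "\<dots> = real (1 + (r - 1) * card (bfs_edges E' v (Suc k)))" by simp
      also have "\<dots> \<le> card (bfs_ball E' v (Suc k))"
        using bfs_ball_tree[OF fE' unif r sp Suc.prems] by (simp only: of_nat_le_iff)
      finally have b: "1 + (1 + x) * ?b \<le> card (bfs_ball E' v (Suc k))" .
      have IH: "(1 + x) ^ (k + 1) - 1 \<le> x * ?b" using Suc.IH Suc.prems by simp
      have "(1 + x) ^ (Suc k + 1) - 1 = x + (1 + x) * ((1 + x) ^ (k + 1) - 1)"
        by (simp add: algebra_simps)
      also have "\<dots> \<le> x + (1 + x) * (x * ?b)"
        using mult_left_mono[OF IH, of "1 + x"] x by linarith
      also have "\<dots> = x * (1 + (1 + x) * ?b)" by (simp add: algebra_simps)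
      also have "\<dots> \<le> x * card (bfs_ball E' v (Suc k))"
        using mult_left_mono[OF b, of x] x by linarith
      finally show ?case .
    qed simp
    have "card (bfs_ball E' v m) \<le> card V"
      using ball[of m] V'(1) V(1) by (intro card_mono) auto
    then have "x * card (bfs_ball E' v m) \<le> x * card V"
      using x by simp
    then have "(1 + x) ^ (m + 1) \<le> 1 + card V * x"
      using growth[of m] by (simp add: mult.commute)
    then have "ln ((1 + x) ^ (m + 1)) \<le> ln (1 + card V * x)"
      using x by (subst ln_le_cancel_iff) (auto intro: add_pos_nonneg)
    then have "(m + 1) * ln (1 + x) \<le> ln (1 + card V * x)"
      using x by (subst (asm) ln_realpow) auto
    then show False using m(2) lx by (simp add: field_simps)
  qed
  then obtain F where F: "F \<subseteq> E'" "F \<noteq> {}" "card F \<le> 2 * m" "card (\<Union>F) \<le> (r - 1) * card F"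
    unfolding sparse_def by (meson not_le)
  show ?thesis
  proof
    show "real (card F) \<le> 2 * ln (1 + card V * x) / ln (1 + x)"
      using F(3) m(1) by simp
  qed (use F E' in auto)
qed

section \<open>Critical density and \<open>t_min\<close>\<close>

lemma avg_degree_ge_c_crit_iff:
  assumes "r \<ge> 2" "card (verts H) > 0"
  shows "avg_degree r H \<ge> c_crit r \<longleftrightarrow> card (verts H) \<le> (r - 1) * card (edges H)"
proof -
  have "avg_degree r H \<ge> c_crit r \<longleftrightarrow>
      real r * real (card (verts H)) \<le> real r * ((real r - 1) * card (edges H))"
    unfolding avg_degree_def c_crit_def using assms by (simp add: field_simps)
  also have "\<dots> \<longleftrightarrow> real (card (verts H)) \<le> (real r - 1) * card (edges H)"
    using assms by (subst mult_le_cancel_left_pos) auto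
  also have "(real r - 1) * card (edges H) = real ((r - 1) * card (edges H))"
    using assms by (simp add: of_nat_diff)
  finally show ?thesis by (simp only: of_nat_le_iff)
qed

lemma t_min_le:
  assumes "\<And>H. dense_rgraph r n d H \<Longrightarrow> \<exists>H'. rgraph r H' \<and> subhypergraph H' H \<and>
      verts H' \<noteq> {} \<and> card (verts H') \<le> t \<and> avg_degree r H' \<ge> s"
  shows "t_min r n d s \<le> t"
  unfolding t_min_def by (rule Least_le) (use assms in blast)

lemma dense_rgraph_self:
  assumes "dense_rgraph r n d H" "s \<le> d"
  shows "rgraph r H \<and> subhypergraph H H \<and> verts H \<noteq> {} \<and> card (verts H) \<le> n \<and> avg_degree r H \<ge> s"
  using assms unfolding dense_rgraph_def subhypergraph_def by auto

lemma t_min_le_n: "s \<le> d \<Longrightarrow> t_min r n d s \<le> n"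
  by (rule t_min_le) (use dense_rgraph_self in blast)

lemma t_min_attained:
  assumes "s \<le> d" "dense_rgraph r n d H"
  shows "\<exists>H'. rgraph r H' \<and> subhypergraph H' H \<and> verts H' \<noteq> {} \<and>
    card (verts H') \<le> t_min r n d s \<and> avg_degree r H' \<ge> s"
proof -
  let ?Q = "\<lambda>t. \<forall>H. dense_rgraph r n d H \<longrightarrow> (\<exists>H'. rgraph r H' \<and> subhypergraph H' H \<and>
    verts H' \<noteq> {} \<and> card (verts H') \<le> t \<and> avg_degree r H' \<ge> s)"
  have "?Q n" using dense_rgraph_self assms(1) by blast
  then have "?Q (t_min r n d s)" unfolding t_min_def by (rule LeastI)
  then show ?thesis using assms(2) by blast
qed

lemma t_min_upper:
  assumes r: "r \<ge> 2" and d: "c_crit r \<le> d" and x: "x = (real r - 1) * d / r - 1" "x > 0"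
  shows "real (t_min r n d (c_crit r)) \<le> 2 * real (r - 1) * (ln (1 + n * x) / ln (1 + x))"
proof -
  let ?b = "2 * real (r - 1) * (ln (1 + n * x) / ln (1 + x))"
  have b0: "?b \<ge> 0" using x by simp
  have "t_min r n d (c_crit r) \<le> nat \<lfloor>?b\<rfloor>"
  proof (rule t_min_le)
    fix H :: "nat hypergraph" assume H: "dense_rgraph r n d H"
    let ?V = "verts H" and ?E = "edges H"
    have V: "finite ?V" "?V \<noteq> {}" and cV: "card ?V = n" and E: "?E \<subseteq> {e. e \<subseteq> ?V \<and> card e = r}"
      and avg: "d \<le> real r * card ?E / n"
      using H unfolding dense_rgraph_def rgraph_def avg_degree_def by auto
    have n: "n > 0" using V cV by auto
    have "d * n \<le> r * card ?E" using avg n by (simp add: field_simps)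
    then have "(real r - 1) * (d * n) \<le> (real r - 1) * (r * card ?E)"
      using r by (intro mult_left_mono) auto
    moreover have "(1 + x) * n = (real r - 1) * (d * n) / r" unfolding x(1) by simp
    ultimately have "(1 + x) * n \<le> (real r - 1) * (r * card ?E) / r"
      using divide_right_mono[of "(real r - 1) * (d * n)" "(real r - 1) * (r * card ?E)" "real r"]
      by (simp only: of_nat_0_le_iff)
    also have "\<dots> = real (r - 1) * card ?E" using r by (simp add: of_nat_diff)
    finally have dense: "(1 + x) * card ?V \<le> real (r - 1) * card ?E" unfolding cV .
    obtain F where F: "F \<subseteq> ?E" "F \<noteq> {}" "card (\<Union>F) \<le> (r - 1) * card F"
        "real (card F) \<le> 2 * ln (1 + card ?V * x) / ln (1 + x)"
      using short_cycle[OF V E r x(2) dense] by blast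
    let ?H = "(\<Union>F, F)"
    have sub: "\<Union>F \<subseteq> ?V" using F(1) E by blast
    then have fin: "finite (\<Union>F)" using V finite_subset by blast
    obtain e where e: "e \<in> F" using F(2) by blast
    then have "card e = r" using F(1) E by auto
    then have "e \<noteq> {}" using r by auto
    then have ne: "\<Union>F \<noteq> {}" using e by blast
    have "real (card (\<Union>F)) \<le> real ((r - 1) * card F)" using F(3) by (simp only: of_nat_le_iff)
    also have "\<dots> = real (r - 1) * card F" by simp
    also have "\<dots> \<le> real (r - 1) * (2 * ln (1 + card ?V * x) / ln (1 + x))"
      by (rule mult_left_mono[OF F(4)]) simp
    also have "\<dots> = ?b" using cV by simp
    finally have "real (card (\<Union>F)) \<le> ?b" .
    then have "card (\<Union>F) \<le> nat \<lfloor>?b\<rfloor>" by (simp add: le_nat_floor)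
    moreover have "rgraph r ?H" using F(1) E fin unfolding rgraph_def by auto
    moreover have "subhypergraph ?H H" using sub F(1) unfolding subhypergraph_def by simp
    moreover have "avg_degree r ?H \<ge> c_crit r"
      using avg_degree_ge_c_crit_iff[OF r, of ?H] F(3) ne fin by (simp add: card_gt_0_iff)
    ultimately show "\<exists>H'. rgraph r H' \<and> subhypergraph H' H \<and> verts H' \<noteq> {} \<and>
        card (verts H') \<le> nat \<lfloor>?b\<rfloor> \<and> avg_degree r H' \<ge> c_crit r"
      using ne by (intro exI[of _ ?H]) simp
  qed
  then have "real (t_min r n d (c_crit r)) \<le> real (nat \<lfloor>?b\<rfloor>)" by (simp only: of_nat_le_iff)
  also have "\<dots> \<le> ?b" using b0 of_nat_floor by blast
  finally show ?thesis .
qed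

lemma t_min_ge:
  fixes V :: "'a set"
  assumes r: "r \<ge> 2" and V: "finite V" "card V \<le> n" and n: "n > 0"
    and E: "E \<subseteq> {e. e \<subseteq> V \<and> card e = r}" and d: "d * n \<le> real r * card E" "c_crit r \<le> d"
    and m: "\<And>F. F \<subseteq> E \<Longrightarrow> F \<noteq> {} \<Longrightarrow> card (\<Union>F) \<le> (r - 1) * card F \<Longrightarrow> m \<le> card (\<Union>F)"
  shows "m \<le> t_min r n d (c_crit r)"
proof -
  obtain h where h: "h ` V \<subseteq> {..<n}" "inj_on h V"
    using card_le_inj[OF V(1), of "{..<n}"] V(2) by auto
  have inj: "inj_on ((`) h) E"
    by (rule inj_on_subset[OF inj_on_image_Pow[OF h(2)]]) (use E in auto)
  let ?H = "({..<n}, (`) h ` E)"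
  have cE: "card ((`) h ` E) = card E" using card_image[OF inj] .
  have "dense_rgraph r n d ?H"
  proof -
    have "h ` e \<subseteq> {..<n} \<and> card (h ` e) = r" if "e \<in> E" for e
    proof -
      have e: "e \<subseteq> V" "card e = r" using that E by auto
      then show ?thesis using h card_image[OF inj_on_subset[OF h(2) e(1)]] by auto
    qed
    moreover have "d \<le> real r * card E / n" using d(1) n by (simp add: field_simps)
    ultimately show ?thesis
      unfolding dense_rgraph_def rgraph_def avg_degree_def using n cE by auto
  qed
  then obtain H' where H': "rgraph r H'" "subhypergraph H' ?H" "verts H' \<noteq> {}"
      "card (verts H') \<le> t_min r n d (c_crit r)" "avg_degree r H' \<ge> c_crit r"
    using t_min_attained[OF d(2)] by blast
  have fV: "finite (verts H')" and UF: "\<Union>(edges H') \<subseteq> verts H'"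
    using H'(1) unfolding rgraph_def by auto
  have c0: "card (verts H') > 0" using fV H'(3) by (simp add: card_gt_0_iff)
  have le: "card (verts H') \<le> (r - 1) * card (edges H')"
    using avg_degree_ge_c_crit_iff[OF r c0] H'(5) by blast
  have "edges H' \<subseteq> (`) h ` E" using H'(2) unfolding subhypergraph_def by simp
  then obtain F where F: "F \<subseteq> E" "edges H' = (`) h ` F" by (auto simp: subset_image_iff)
  have cF: "card (edges H') = card F"
    unfolding F(2) by (rule card_image[OF inj_on_subset[OF inj F(1)]])
  have U: "\<Union>(edges H') = h ` \<Union>F" unfolding F(2) by blast
  have "\<Union>F \<subseteq> V" using F(1) E by blast
  then have cU: "card (\<Union>(edges H')) = card (\<Union>F)"
    unfolding U by (intro card_image inj_on_subset[OF h(2)])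
  have cUV: "card (\<Union>F) \<le> card (verts H')" using card_mono[OF fV UF] cU by simp
  have "F \<noteq> {}" using le c0 cF by auto
  then have "m \<le> card (\<Union>F)" using m[OF F(1)] cUV le cF by simp
  then show ?thesis using cUV H'(4) by linarith
qed

text \<open>Sparsity counts edges whereas \<open>t_min\<close> counts vertices. A dense
  \<open>F\<close> on at most \<open>g\<close> vertices would have more than \<open>g\<close> edges,
  but any \<open>g\<close> of them already span more than \<open>(r - 1) * g \<ge> g\<close>
  vertices.\<close>

lemma sparse_less_t_min:
  fixes V :: "'a set"
  assumes r: "r \<ge> 2" and V: "finite V" "card V \<le> n" and n: "n > 0"
    and E: "E \<subseteq> {e. e \<subseteq> V \<and> card e = r}" and d: "d * n \<le> real r * card E" "c_crit r \<le> d"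
    and sp: "sparse r g E"
  shows "g < t_min r n d (c_crit r)"
proof -
  have "Suc g \<le> t_min r n d (c_crit r)"
  proof (rule t_min_ge[OF r V n E d])
    fix F assume F: "F \<subseteq> E" "F \<noteq> {}" "card (\<Union>F) \<le> (r - 1) * card F"
    show "Suc g \<le> card (\<Union>F)"
    proof (rule ccontr)
      assume "\<not> ?thesis"
      then have g: "card (\<Union>F) \<le> g" by simp
      have "\<not> card F \<le> g" using sparseD[OF sp F(1,2)] F(3) by linarith
      then have "g \<le> card F" by simp
      then obtain F' where F': "F' \<subseteq> F" "card F' = g"
        by (rule obtain_subset_with_card_n)
      obtain e where e: "e \<in> F" using F(2) by blast
      have "\<Union>F \<subseteq> V" using F(1) E by auto
      then have finU: "finite (\<Union>F)" using V(1) by (rule finite_subset)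
      have "card e = r" using e F(1) E by auto
      then have "e \<noteq> {}" using r by auto
      then have "card (\<Union>F) > 0" using e finU by (auto simp: card_gt_0_iff)
      then have "F' \<noteq> {}" using F'(2) g by auto
      then have "(r - 1) * g < card (\<Union>F')" using sparseD[OF sp, of F'] F' F(1) by auto
      also have "\<dots> \<le> card (\<Union>F)" using finU F'(1) by (intro card_mono) auto
      also have "\<dots> \<le> g" by (fact g)
      finally show False using r by (cases "r - 1") auto
    qed
  qed
  then show ?thesis by simp
qed

section \<open>Greedy construction of sparse hypergraphs\<close>

text \<open>The component \<open>C\<close> of \<open>x\<close> in \<open>F\<close> has at most
  \<open>g\<close> edges, so it stays in the ball of radius \<open>g\<close> and misses all later
  entries of \<open>xs\<close>. It spans at least \<open>1 + (r - 1) * card C\<close> vertices with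
  \<open>x\<close>, disjoint from the rest, which induction handles. Farness of later entries from
  earlier ones suits both this induction and the greedy choice.\<close>

lemma card_Union_far:
  assumes fin: "finite E" "\<And>e. e \<in> E \<Longrightarrow> finite e" and sp: "sparse r g E"
    and "F \<subseteq> E" "card F \<le> g" "sorted_wrt (\<lambda>x y. y \<notin> bfs_ball E x g) xs"
  shows "(r - 1) * card F + length xs \<le> card (\<Union>F \<union> set xs)"
  using assms(4-6)
proof (induction xs arbitrary: F)
  case Nil
  show ?case
  proof (cases "F = {}")
    case False
    show ?thesis using sparseD[OF sp Nil(1) False Nil(2)] by simp
  qed simp
next
  case (Cons x xs)
  have fF: "finite F" using Cons.prems(1) fin(1) by (rule finite_subset)
  have fe: "finite e" if "e \<in> F" for e using that Cons.prems(1) fin(2) by blast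
  have "finite {C. C \<subseteq> F \<and> conn x C}" using fF by simp
  moreover have "{C. C \<subseteq> F \<and> conn x C} \<noteq> {}" using conn_empty[of x] by blast
  ultimately obtain C where C: "C \<subseteq> F" "conn x C"
    and max: "\<And>D. D \<subseteq> F \<Longrightarrow> conn x D \<Longrightarrow> C \<subseteq> D \<Longrightarrow> C = D"
    using finite_has_maximal[of "{C. C \<subseteq> F \<and> conn x C}"] by auto
  have fC: "finite C" using C(1) fF by (rule finite_subset)
  have away: "e \<inter> insert x (\<Union>C) = {}" if "e \<in> F - C" for e
  proof (rule ccontr)
    assume "e \<inter> insert x (\<Union>C) \<noteq> {}"
    then have "conn x (insert e C)" by (rule conn_insert[OF C(2)])
    then have "C = insert e C" using max[of "insert e C"] C(1) that by blast
    then show False using that by blast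
  qed
  have cC: "card C \<le> g" using card_mono[OF fF C(1)] Cons.prems(2) by linarith
  have "insert x (\<Union>C) \<subseteq> bfs_ball E x (card C)"
    by (rule conn_subset_ball[OF C(2)]) (use C(1) Cons.prems(1) in blast)
  also have "\<dots> \<subseteq> bfs_ball E x g" using bfs_edges_mono[OF cC, of E x] by blast
  finally have inball: "insert x (\<Union>C) \<subseteq> bfs_ball E x g" .
  have far: "y \<notin> bfs_ball E x g" if "y \<in> set xs" for y using Cons.prems(3) that by simp
  have "finite (\<Union>C)" using fC C(1) fe by blast
  have c1: "1 + (r - 1) * card C \<le> card (insert x (\<Union>C))"
  proof (cases "C = {}")
    case False
    have "(r - 1) * card C < card (\<Union>C)"
      by (rule sparseD[OF sp _ False cC]) (use C(1) Cons.prems(1) in blast)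
    also have "\<dots> \<le> card (insert x (\<Union>C))" using \<open>finite (\<Union>C)\<close> by (intro card_mono) auto
    finally show ?thesis by simp
  qed simp
  let ?G = "F - C"
  have "card ?G \<le> g" using card_mono[OF fF, of ?G] Cons.prems(2) by auto
  then have IH: "(r - 1) * card ?G + length xs \<le> card (\<Union>?G \<union> set xs)"
    by (intro Cons.IH) (use Cons.prems(1,3) in auto)
  have fG: "finite (\<Union>?G \<union> set xs)" using fF fe by auto
  have "insert x (\<Union>C) \<inter> (\<Union>?G \<union> set xs) = {}"
    using away far inball by blast
  then have "card (insert x (\<Union>C) \<union> (\<Union>?G \<union> set xs)) =
      card (insert x (\<Union>C)) + card (\<Union>?G \<union> set xs)"
    using \<open>finite (\<Union>C)\<close> fG by (intro card_Un_disjoint) auto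
  moreover have "insert x (\<Union>C) \<union> (\<Union>?G \<union> set xs) = \<Union>F \<union> set (x # xs)"
    using C(1) by auto
  moreover have "card F = card C + card ?G"
    using card_Un_disjoint[of C ?G] fC fF C(1) by (simp add: Un_absorb1)
  ultimately show ?case using c1 IH by (simp add: distrib_left)
qed

text \<open>A vertex of the ball lies in at most \<open>D\<close> edges of \<open>r\<close>
  vertices, so each layer multiplies the order by at most \<open>1 + r * D\<close>.\<close>

lemma card_bfs_ball_le:
  assumes fin: "finite E" and unif: "\<And>e. e \<in> E \<Longrightarrow> finite e \<and> card e = r"
    and deg: "\<And>v. card {e \<in> E. v \<in> e} \<le> D"
  shows "card (bfs_ball E x k) \<le> (1 + r * D) ^ k"
proof (induction k)
  case (Suc k)
  let ?B = "bfs_ball E x k"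
  have finB: "finite (bfs_edges E x k)" using bfs_edges_subset fin by (rule finite_subset)
  have fB: "finite ?B" using finB bfs_edges_subset[of E x k] unif by blast
  have star: "card (\<Union>{e \<in> E. y \<in> e}) \<le> r * D" for y
  proof -
    have "card (\<Union>{e \<in> E. y \<in> e}) \<le> sum card {e \<in> E. y \<in> e}"
      using card_Union_le_sum_card by blast
    also have "\<dots> = card {e \<in> E. y \<in> e} * r" using unif by simp
    also have "\<dots> \<le> r * D" using deg[of y] by (simp add: mult.commute)
    finally show ?thesis .
  qed
  have fs: "finite (\<Union>{e \<in> E. y \<in> e})" for y using fin unif by auto
  have "bfs_ball E x (Suc k) \<subseteq> ?B \<union> (\<Union>y\<in>?B. \<Union>{e \<in> E. y \<in> e})" by auto
  then have "card (bfs_ball E x (Suc k)) \<le> card (?B \<union> (\<Union>y\<in>?B. \<Union>{e \<in> E. y \<in> e}))"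
    by (rule card_mono[rotated]) (use fB fs in blast)
  also have "\<dots> \<le> card ?B + card (\<Union>y\<in>?B. \<Union>{e \<in> E. y \<in> e})" by (rule card_Un_le)
  also have "card (\<Union>y\<in>?B. \<Union>{e \<in> E. y \<in> e}) \<le> (\<Sum>y\<in>?B. card (\<Union>{e \<in> E. y \<in> e}))"
    by (rule card_UN_le[OF fB])
  also have "\<dots> \<le> (\<Sum>y\<in>?B. r * D)" by (rule sum_mono) (rule star)
  also have "card ?B + (\<Sum>y\<in>?B. r * D) = card ?B * (1 + r * D)" by simp
  also have "\<dots> \<le> (1 + r * D) ^ k * (1 + r * D)" using Suc.IH by (intro mult_le_mono1)
  finally show ?case by (simp only: power_Suc2)
qed simp

text \<open>Greedy choice: the sets \<open>B x\<close> of the vertices chosen so far cannot cover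
  \<open>S\<close>, and an uncovered vertex is appended at the end.\<close>

lemma far_list_exists:
  assumes "\<And>x. finite (B x) \<and> card (B x) \<le> q" "m * q \<le> card S" "q > 0" "finite S"
  obtains xs where "length xs = m" "set xs \<subseteq> S" "sorted_wrt (\<lambda>x y. y \<notin> B x) xs"
  using assms(2)
proof (induction m arbitrary: thesis)
  case (Suc m)
  obtain xs where xs: "length xs = m" "set xs \<subseteq> S" "sorted_wrt (\<lambda>x y. y \<notin> B x) xs"
    using Suc.IH Suc.prems(2) by auto
  have "card (\<Union>x\<in>set xs. B x) \<le> (\<Sum>x\<in>set xs. card (B x))" by (rule card_UN_le) simp
  also have "\<dots> \<le> (\<Sum>x\<in>set xs. q)" by (rule sum_mono) (use assms(1) in blast)
  also have "\<dots> \<le> m * q" using card_length[of xs] xs(1) by simp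
  also have "\<dots> < card S" using Suc.prems(2) assms(3) by simp
  finally have "card (\<Union>x\<in>set xs. B x) < card S" .
  then have "\<not> S \<subseteq> (\<Union>x\<in>set xs. B x)"
    using card_mono[of "\<Union>x\<in>set xs. B x" S] assms(1) by auto
  then obtain y where "y \<in> S" "y \<notin> (\<Union>x\<in>set xs. B x)" by blast
  then show ?case using Suc.prems(1)[of "xs @ [y]"] xs by (auto simp: sorted_wrt_append)
qed auto

text \<open>Greedy construction: as long as many vertices have degree below \<open>D\<close>, some \<open>u\<close> of them
  are pairwise far apart and can be joined by a new edge.\<close>

lemma dense_sparse_exists:
  assumes u: "u \<ge> 2" and g: "g \<ge> 1" and N: "2 * u * (1 + u * D) ^ g \<le> N"
  obtains E where "E \<subseteq> {e. e \<subseteq> {..<N} \<and> card e = u}" "sparse u g E" "N * D \<le> 2 * u * card E"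
proof -
  let ?A = "{e. e \<subseteq> {..<N} \<and> card e = u}"
  have finA: "finite ?A" by simp
  define Fam where "Fam = {E. E \<subseteq> ?A \<and> sparse u g E \<and> (\<forall>v. card {e \<in> E. v \<in> e} \<le> D)}"
  have "finite Fam" unfolding Fam_def using finA by simp
  moreover have "Fam \<noteq> {}" unfolding Fam_def sparse_def by (auto intro!: exI[of _ "{}"])
  ultimately obtain E where E: "E \<in> Fam" and max: "\<And>E'. E' \<in> Fam \<Longrightarrow> E \<subseteq> E' \<Longrightarrow> E = E'"
    using finite_has_maximal[of Fam] by auto
  have EA: "E \<subseteq> ?A" and sp: "sparse u g E" and deg: "\<And>v. card {e \<in> E. v \<in> e} \<le> D"
    using E unfolding Fam_def by auto
  have finE: "finite E" using EA finA by (rule finite_subset)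
  have unif: "finite e \<and> card e = u" if "e \<in> E" for e
    using that EA finite_subset[of e "{..<N}"] by auto
  define S where "S = {v. v < N \<and> card {e \<in> E. v \<in> e} < D}"
  have finS: "finite S" unfolding S_def by simp
  \<comment> \<open>\<open>S\<close> holds the vertices that can still take an edge. Were it large,
    \<open>u\<close> far apart ones would form a new edge, against maximality.\<close>
  have S: "card S < u * (1 + u * D) ^ g"
  proof (rule ccontr)
    assume "\<not> ?thesis"
    then have le: "u * (1 + u * D) ^ g \<le> card S" by simp
    have B: "finite (bfs_ball E x g) \<and> card (bfs_ball E x g) \<le> (1 + u * D) ^ g" for x
    proof
      have "finite (bfs_edges E x g)" using bfs_edges_subset finE by (rule finite_subset)
      then show "finite (bfs_ball E x g)" using bfs_edges_subset[of E x g] unif by blast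
    qed (rule card_bfs_ball_le[OF finE unif deg])
    obtain xs where xs: "length xs = u" "set xs \<subseteq> S"
        "sorted_wrt (\<lambda>x y. y \<notin> bfs_ball E x g) xs"
      by (rule far_list_exists[of "\<lambda>x. bfs_ball E x g", OF B le _ finS]) auto
    have "distinct xs" using xs(3) by (induction xs) auto
    define f where "f = set xs"
    have cf: "card f = u" unfolding f_def using distinct_card[OF \<open>distinct xs\<close>] xs(1) by simp
    have fA: "f \<in> ?A" using cf xs(2) unfolding f_def S_def by auto
    \<comment> \<open>If \<open>f\<close> were already an edge, its second vertex would lie in the
      ball of radius \<open>1 \<le> g\<close> around the first.\<close>
    have fE: "f \<notin> E"
    proof
      assume f: "f \<in> E"
      obtain x y zs where xyz: "xs = x # y # zs"
        using xs(1) u by (cases xs; cases "tl xs") auto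
      have "f \<in> bfs_edges E x (Suc 0)" using f unfolding f_def xyz by simp
      moreover have "Suc 0 \<le> g" using g by simp
      ultimately have "f \<in> bfs_edges E x g" using bfs_edges_mono[of "Suc 0" g E x] by (meson subsetD)
      moreover have "y \<in> f" unfolding f_def xyz by simp
      ultimately have "y \<in> bfs_ball E x g" by (intro insertI2 UnionI)
      then show False using xs(3) unfolding xyz sorted_wrt.simps by (meson list.set_intros(1))
    qed
    have "sparse u g (insert f E)"
      unfolding sparse_def
    proof (intro allI impI)
      fix F assume F: "F \<subseteq> insert f E" "F \<noteq> {} \<and> card F \<le> g"
      show "(u - 1) * card F < card (\<Union>F)"
      proof (cases "f \<in> F")
        case False
        then show ?thesis using F sparseD[OF sp, of F] by blast
      next
        case True
        have finF: "finite F" by (rule finite_subset[OF F(1)]) (simp add: finE)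
        then have c: "card F = Suc (card (F - {f}))" using True card_Suc_Diff1 by metis
        \<comment> \<open>With \<open>length xs = u\<close> the left side is
          \<open>(u - 1) * card F + 1\<close>, which gives the strict inequality.\<close>
        have "(u - 1) * card (F - {f}) + length xs \<le> card (\<Union>(F - {f}) \<union> set xs)"
        proof (rule card_Union_far[OF finE _ sp _ _ xs(3)])
          show "finite e" if "e \<in> E" for e using unif[OF that] by simp
          show "F - {f} \<subseteq> E" using F(1) by blast
          show "card (F - {f}) \<le> g" using F(2) c by simp
        qed
        also have "\<Union>(F - {f}) \<union> set xs = \<Union>F" using True unfolding f_def by blast
        finally show ?thesis unfolding c using xs(1) u by simp
      qed
    qed
    moreover have "card {e \<in> insert f E. v \<in> e} \<le> D" for v
    proof (cases "v \<in> f")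
      case True
      then have "card {e \<in> E. v \<in> e} < D" using xs(2) unfolding f_def S_def by auto
      moreover have "{e \<in> insert f E. v \<in> e} = insert f {e \<in> E. v \<in> e}" using True by auto
      ultimately show ?thesis using finE fE by simp
    next
      case False
      then have "{e \<in> insert f E. v \<in> e} = {e \<in> E. v \<in> e}" by auto
      then show ?thesis using deg by simp
    qed
    ultimately have "insert f E \<in> Fam" unfolding Fam_def using EA fA by auto
    then show False using max[of "insert f E"] fE by blast
  qed
  have SN: "S \<subseteq> {..<N}" unfolding S_def by auto
  \<comment> \<open>At least half of the vertices lie outside \<open>S\<close> and have degree
    \<open>D\<close>; double counting incidences gives
    \<open>N * D / 2 \<le> u * card E\<close>.\<close>
  have "2 * card S \<le> N" using S N by simp
  then have "N \<le> 2 * card ({..<N} - S)" using card_Diff_subset[OF finS SN] by simp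
  then have "N * D \<le> 2 * card ({..<N} - S) * D" by (rule mult_le_mono1)
  then have "N * D \<le> 2 * (card ({..<N} - S) * D)" by (simp only: mult.assoc)
  also have "card ({..<N} - S) * D = (\<Sum>v\<in>{..<N} - S. D)" by simp
  also have "\<dots> \<le> (\<Sum>v\<in>{..<N} - S. card {e \<in> E. v \<in> e})"
    by (rule sum_mono) (auto simp: S_def)
  also have "\<dots> \<le> (\<Sum>v<N. card {e \<in> E. v \<in> e})" by (rule sum_mono2) auto
  also have "\<dots> = (\<Sum>v<N. \<Sum>e\<in>E. if v \<in> e then 1 else 0)"
    unfolding card_eq_sum by (intro sum.cong refl sum.inter_filter finE)
  also have "\<dots> = (\<Sum>e\<in>E. \<Sum>v<N. if v \<in> e then 1 else 0)" by (rule sum.swap)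
  also have "\<dots> = (\<Sum>e\<in>E. u)"
  proof (rule sum.cong[OF refl])
    fix e assume "e \<in> E"
    then have e: "e \<subseteq> {..<N}" "card e = u" using EA by auto
    have "(\<Sum>v<N. if v \<in> e then 1 else 0) = card {v \<in> {..<N}. v \<in> e}"
      unfolding card_eq_sum by (rule sum.inter_filter[symmetric]) simp
    also have "{v \<in> {..<N}. v \<in> e} = e" using e by auto
    finally show "(\<Sum>v<N. if v \<in> e then 1 else 0) = u" using e by simp
  qed
  finally have "N * D \<le> 2 * (card E * u)" by simp
  then have "N * D \<le> 2 * u * card E" by (simp add: ac_simps)
  then show ?thesis by (rule that[OF EA sp])
qed

section \<open>Padding and subdividing graphs\<close>

text \<open>Private vertices are tagged with their edge, so distinct padded edges meet only in
  original vertices.\<close>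

definition pad :: "nat \<Rightarrow> 'a set \<Rightarrow> ('a + 'a set \<times> nat) set" where
  "pad r e = Inl ` e \<union> (\<lambda>i. Inr (e, i)) ` {..<r - 2}"

lemma inj_pad: "inj (pad r)"
proof (rule injI)
  fix e f :: "'a set" assume "pad r e = pad r f"
  then have "Inl -` pad r e = Inl -` pad r f" by simp
  then show "e = f" unfolding pad_def by (auto simp: vimage_def image_iff)
qed

lemma card_pad: "finite e \<Longrightarrow> card (pad r e) = card e + (r - 2)"
  unfolding pad_def
  by (subst card_Un_disjoint) (auto simp: card_image inj_on_def)

text \<open>Padding raises the number of spanned vertices and the threshold by the same
  \<open>(r - 2) * card F\<close>, so strictness carries over.\<close>

lemma sparse_pad:
  assumes r: "r \<ge> 2" and fin: "finite E" "\<And>e. e \<in> E \<Longrightarrow> finite e" and sp: "sparse 2 g E"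
  shows "sparse r g (pad r ` E)"
  unfolding sparse_def
proof (intro allI impI)
  fix F' assume F': "F' \<subseteq> pad r ` E" "F' \<noteq> {} \<and> card F' \<le> g"
  then obtain F where F: "F \<subseteq> E" "F' = pad r ` F" by (auto simp: subset_image_iff)
  have cF: "card F' = card F"
    unfolding F(2) by (rule card_image) (use inj_pad inj_on_subset in blast)
  have finF: "finite F" using F(1) fin(1) by (rule finite_subset)
  have "1 * card F < card (\<Union>F)" using sparseD[OF sp F(1)] F' F(2) cF by auto
  then have sp1: "card F < card (\<Union>F)" by simp
  have finU: "finite (\<Union>F)" using finF F(1) fin(2) by auto
  have "\<Union>F' = Inl ` \<Union>F \<union> Inr ` (F \<times> {..<r - 2})"
    unfolding F(2) pad_def by auto
  moreover have "card (Inl ` \<Union>F \<union> Inr ` (F \<times> {..<r - 2}) :: ('a + 'a set \<times> nat) set) =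
      card (\<Union>F) + card F * (r - 2)"
    using finF finU by (subst card_Un_disjoint) (auto simp: card_image card_cartesian_product)
  ultimately have "card (\<Union>F') = card (\<Union>F) + card F * (r - 2)" by simp
  moreover have "(r - 1) * card F = card F + card F * (r - 2)"
  proof -
    have "r - 1 = Suc (r - 2)" using r by simp
    then show ?thesis by simp
  qed
  ultimately show "(r - 1) * card F' < card (\<Union>F')" using sp1 cF by simp
qed

text \<open>Subdivision of a graph on linearly ordered vertices: \<open>e\<close> becomes a path of length \<open>L e\<close>
  from \<open>Min e\<close> to \<open>Max e\<close>, with interior vertices \<open>Inr (e, k)\<close>.\<close>

definition joint :: "('a::linorder set \<Rightarrow> nat) \<Rightarrow> 'a set \<Rightarrow> nat \<Rightarrow> 'a + 'a set \<times> nat" where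
  "joint L e k = (if k = 0 then Inl (Min e) else if k = L e then Inl (Max e) else Inr (e, k))"

definition link :: "('a::linorder set \<Rightarrow> nat) \<Rightarrow> 'a set \<times> nat \<Rightarrow> ('a + 'a set \<times> nat) set" where
  "link L = (\<lambda>(e, k). {joint L e k, joint L e (Suc k)})"

lemma pair_eq_Min_Max:
  fixes e :: "'a::linorder set"
  assumes "card e = 2"
  shows "e = {Min e, Max e}" "Min e \<noteq> Max e"
proof -
  obtain a b where ab: "e = {a, b}" "a \<noteq> b" using assms by (auto simp: card_2_iff)
  then show "e = {Min e, Max e}" "Min e \<noteq> Max e" by (cases "a \<le> b"; auto simp: min_def max_def)+
qed

lemma joint_inj:
  assumes "card e = 2" "k \<le> L e" "k' \<le> L e" "joint L e k = joint L e k'"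
  shows "k = k'"
  using assms pair_eq_Min_Max(2)[of e] unfolding joint_def by (auto split: if_splits)

context
  fixes E :: "'a::linorder set set" and L :: "'a set \<Rightarrow> nat"
  assumes two: "\<And>e. e \<in> E \<Longrightarrow> card e = 2" and L: "\<And>e. e \<in> E \<Longrightarrow> 2 \<le> L e" and fin: "finite E"
begin

lemma card_link: "p \<in> Sigma E (\<lambda>e. {..<L e}) \<Longrightarrow> card (link L p) = 2"
  using joint_inj[of "fst p" "snd p" L "Suc (snd p)"] two
  by (auto simp: link_def card_insert_if)

lemma inj_on_link: "inj_on (link L) (Sigma E (\<lambda>e. {..<L e}))"
proof (rule inj_onI)
  fix p q assume pq: "p \<in> Sigma E (\<lambda>e. {..<L e})" "q \<in> Sigma E (\<lambda>e. {..<L e})"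
    "link L p = link L q"
  obtain e k e' k' where e: "p = (e, k)" "q = (e', k')" by fastforce
  have E: "e \<in> E" "k < L e" "e' \<in> E" "k' < L e'" using pq e by auto
  \<comment> \<open>As \<open>2 \<le> L e\<close>, every piece of the path has an interior vertex,
    whose tag identifies \<open>e\<close>.\<close>
  have "Inr (e, k) \<in> link L p \<or> Inr (e, Suc k) \<in> link L p"
    using L[OF E(1)] E(2) unfolding e link_def joint_def by auto
  then have "Inr (e, k) \<in> link L q \<or> Inr (e, Suc k) \<in> link L q" using pq by simp
  then have ee: "e = e'" unfolding e link_def joint_def by (auto split: if_splits)
  have "{joint L e k, joint L e (Suc k)} = {joint L e k', joint L e (Suc k')}"
    using pq(3) unfolding e ee link_def by simp
  then have "joint L e k = joint L e k' \<or>
      joint L e k = joint L e (Suc k') \<and> joint L e (Suc k) = joint L e k'"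
    by (auto simp: doubleton_eq_iff)
  then have "k = k' \<or> k = Suc k' \<and> Suc k = k'"
    using joint_inj[of e _ L, OF two[OF E(1)]] E ee by (metis Suc_leI less_imp_le)
  then show "p = q" using e ee by auto
qed

lemma link_subset:
  assumes "p \<in> Sigma E (\<lambda>e. {..<L e})" "\<Union>E \<subseteq> V"
  shows "link L p \<subseteq> Inl ` V \<union> Inr ` Sigma E (\<lambda>e. {1..<L e})"
proof -
  obtain e k where p: "p = (e, k)" "e \<in> E" "k < L e" using assms(1) by auto
  have "Min e \<in> V" "Max e \<in> V" using pair_eq_Min_Max(1)[OF two[OF p(2)]] p(2) assms(2) by blast+
  then show ?thesis unfolding p(1) link_def joint_def using p by auto
qed

text \<open>In \<open>F\<close>, let \<open>K e\<close> be the used pieces of the path of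
  \<open>e\<close>, \<open>M e\<close> its interior vertices met, \<open>J\<close> the original
  vertices met and \<open>A\<close> the edges whose path is fully used. A partly used path has at
  least as many interior vertices as pieces; a full one may fall short by one. Sparsity of
  \<open>E\<close> gives \<open>card A < card J\<close>, which outweighs this deficit.\<close>

lemma sparse_subdivide:
  assumes sp: "sparse 2 g E" and l: "\<And>e. e \<in> E \<Longrightarrow> l \<le> L e" "l > 0"
  shows "sparse 2 (l * g) (link L ` Sigma E (\<lambda>e. {..<L e}))"
  unfolding sparse_def
proof (intro allI impI)
  let ?I = "Sigma E (\<lambda>e. {..<L e})"
  fix F assume F: "F \<subseteq> link L ` ?I" "F \<noteq> {} \<and> card F \<le> l * g"
  then obtain I where I: "I \<subseteq> ?I" "F = link L ` I" by (auto simp: subset_image_iff)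
  define K where "K e = {k. (e, k) \<in> I}" for e
  have KL: "K e \<subseteq> {..<L e}" for e using I(1) unfolding K_def by auto
  have finK: "finite (K e)" for e using KL finite_subset by blast
  have IK: "I = Sigma E K" using I(1) unfolding K_def by auto
  have cF: "card F = (\<Sum>e\<in>E. card (K e))"
  proof -
    have "card F = card I" unfolding I(2) by (rule card_image[OF inj_on_subset[OF inj_on_link I(1)]])
    also have "\<dots> = (\<Sum>e\<in>E. card (K e))" unfolding IK using fin finK by (simp add: card_SigmaI)
    finally show ?thesis .
  qed
  define J where "J = {v. Inl v \<in> \<Union>F}"
  define M where "M e = {k. Inr (e, k) \<in> \<Union>F}" for e
  have finF: "finite (\<Union>F)" unfolding I(2) IK using fin finK by (auto simp: link_def)
  have finJ: "finite J" unfolding J_def using finite_vimageI[OF finF, of Inl] by (simp add: vimage_def)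
  have finM: "finite (M e)" for e
    unfolding M_def using finite_vimageI[OF finF, of "\<lambda>k. Inr (e, k)"]
    by (simp add: vimage_def inj_on_def)
  have "card (Inl ` J \<union> Inr ` Sigma E M :: ('a + 'a set \<times> nat) set) = card J + (\<Sum>e\<in>E. card (M e))"
    using finJ finM fin by (subst card_Un_disjoint) (auto simp: card_image card_SigmaI)
  moreover have "Inl ` J \<union> Inr ` Sigma E M \<subseteq> \<Union>F" unfolding J_def M_def by auto
  ultimately have lower: "card J + (\<Sum>e\<in>E. card (M e)) \<le> card (\<Union>F)"
    using card_mono[OF finF] by metis
  have inF: "joint L e k \<in> \<Union>F" "joint L e (Suc k) \<in> \<Union>F" if "k \<in> K e" for e k
    using that unfolding I(2) K_def by (force simp: link_def)+
  have M1: "k \<in> M e" if "k \<in> K e" "0 < k" for e k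
  proof -
    have "k < L e" using that(1) KL[of e] by auto
    then show ?thesis using inF(1)[OF that(1)] that(2) unfolding joint_def M_def by simp
  qed
  have M2: "Suc k \<in> M e" if "k \<in> K e" "Suc k < L e" for e k
    using inF(2)[OF that(1)] that(2) unfolding joint_def M_def by simp
  define A where "A = {e \<in> E. K e = {..<L e}}"
  have AE: "A \<subseteq> E" unfolding A_def by auto
  have finA: "finite A" using AE fin by (rule finite_subset)
  have part: "card (K e) \<le> card (M e)" if e: "e \<in> E - A" for e
  proof -
    obtain \<rho> where \<rho>: "\<rho> < L e" "\<rho> \<notin> K e" using e KL[of e] unfolding A_def by blast
    \<comment> \<open>The missing piece \<open>\<rho>\<close> cuts the path: pieces before it are
      matched with their right ends, later ones with their left ends, all interior and
      distinct.\<close>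
    let ?f = "\<lambda>k. if k < \<rho> then Suc k else k"
    have neq: "k \<noteq> \<rho>" if "k \<in> K e" for k using that \<rho> by auto
    have "inj_on ?f (K e)"
    proof (rule inj_onI)
      fix a b assume "a \<in> K e" "b \<in> K e" "?f a = ?f b"
      then show "a = b" using neq[of a] neq[of b] by (simp split: if_splits)
    qed
    moreover have "?f ` K e \<subseteq> M e"
    proof
      fix y assume "y \<in> ?f ` K e"
      then obtain k where k: "k \<in> K e" "y = ?f k" by blast
      show "y \<in> M e" using M1[OF k(1)] M2[OF k(1)] neq[OF k(1)] \<rho>(1) k(2) by (cases "k < \<rho>") auto
    qed
    ultimately show ?thesis using finM by (rule card_inj_on_le)
  qed
  have "card F < card (\<Union>F)"
  proof (cases "A = {}")
    case True
    have le: "card (K e) \<le> card (M e)" if "e \<in> E" for e using part that True by blast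
    show ?thesis
    proof (cases "J = {}")
      case False
      then have "card J > 0" using finJ by (simp add: card_gt_0_iff)
      moreover have "(\<Sum>e\<in>E. card (K e)) \<le> (\<Sum>e\<in>E. card (M e))" by (rule sum_mono) (rule le)
      ultimately show ?thesis using lower cF by linarith
    next
      \<comment> \<open>No original vertex is met, so a used path segment lies strictly inside:
        besides the left ends indexed by \<open>K e\<close>, the right end of the last piece is an
        extra interior vertex.\<close>
      case J: True
      obtain e k where ek: "e \<in> E" "k \<in> K e" using F(2) I(2) IK by auto
      have no0: "0 \<notin> K e" using inF(1)[of 0 e] J unfolding J_def joint_def by auto
      have noL: "Suc j \<noteq> L e" if "j \<in> K e" for j
        using inF(2)[OF that] J unfolding J_def joint_def by auto
      define j where "j = Max (K e)"
      have j: "j \<in> K e" unfolding j_def by (rule Max_in[OF finK]) (use ek in auto)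
      have j': "Suc j \<notin> K e"
      proof
        assume "Suc j \<in> K e"
        then have "Suc j \<le> j" unfolding j_def by (rule Max_ge[OF finK])
        then show False by simp
      qed
      have "Suc j < L e" using noL[OF j] j KL[of e] by fastforce
      then have "Suc j \<in> M e" by (rule M2[OF j])
      moreover have "K e \<subseteq> M e" 
      proof
        fix i assume i: "i \<in> K e"
        then have "0 < i" using no0 by (cases i) auto
        then show "i \<in> M e" by (rule M1[OF i])
      qed
      ultimately have "insert (Suc j) (K e) \<subseteq> M e" by simp
      then have "card (K e) < card (M e)" using card_mono[OF finM, of "insert (Suc j) (K e)" e] j' finK[of e] by simp
      then have "(\<Sum>e\<in>E. card (K e)) < (\<Sum>e\<in>E. card (M e))"
        by (intro sum_strict_mono_ex1) (use fin le ek in auto)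
      then show ?thesis using lower cF by linarith
    qed
  next
    case False
    have Kfull: "card (K e) = L e" if "e \<in> A" for e using that unfolding A_def by simp
    \<comment> \<open>A full path uses at least \<open>l\<close> of the at most \<open>l * g\<close>
      pieces, so \<open>A\<close> is small enough for the sparsity of \<open>E\<close>.\<close>
    have "l * card A = (\<Sum>e\<in>A. l)" by simp
    also have "\<dots> \<le> (\<Sum>e\<in>A. card (K e))" by (rule sum_mono) (use Kfull l(1) AE in auto)
    also have "\<dots> \<le> card F" unfolding cF by (rule sum_mono2[OF fin AE]) simp
    also have "\<dots> \<le> l * g" using F by simp
    finally have "card A \<le> g" using l(2) by simp
    then have "(2 - 1) * card A < card (\<Union>A)" by (rule sparseD[OF sp AE False])
    also have "\<Union>A \<subseteq> J"
    proof
      fix v assume "v \<in> \<Union>A"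
      then obtain e where e: "e \<in> A" "v \<in> e" by blast
      then have eE: "e \<in> E" and K: "K e = {..<L e}" unfolding A_def by auto
      have Le: "2 \<le> L e" using L eE by blast
      have "Inl (Min e) \<in> \<Union>F" using inF(1)[of 0 e] K Le by (simp add: joint_def)
      moreover have "Inl (Max e) \<in> \<Union>F" using inF(2)[of "L e - 1" e] K Le by (simp add: joint_def)
      moreover have "v = Min e \<or> v = Max e"
        using e(2) pair_eq_Min_Max(1)[OF two[OF eE]] by blast
      ultimately show "v \<in> J" unfolding J_def by blast
    qed
    then have "card (\<Union>A) \<le> card J" by (rule card_mono[OF finJ])
    finally have cJ: "card A < card J" by simp
    have full: "card (K e) \<le> card (M e) + 1" if e: "e \<in> A" for e
    proof -
      have "{1..<L e} \<subseteq> M e"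
      proof
        fix k assume "k \<in> {1..<L e}"
        then have "k \<in> K e" "0 < k" using e unfolding A_def by auto
        then show "k \<in> M e" by (rule M1)
      qed
      then have "L e - 1 \<le> card (M e)" using card_mono[OF finM, of "{1..<L e}" e] by simp
      then show ?thesis using Kfull[OF e] by simp
    qed
    have "card F = (\<Sum>e\<in>A. card (K e)) + (\<Sum>e\<in>E - A. card (K e))"
      unfolding cF using sum.subset_diff[OF AE fin] by (simp add: add.commute)
    also have "(\<Sum>e\<in>A. card (K e)) \<le> (\<Sum>e\<in>A. card (M e) + 1)" by (rule sum_mono) (rule full)
    also have "(\<Sum>e\<in>A. card (M e) + 1) = (\<Sum>e\<in>A. card (M e)) + card A"
      by (simp only: sum.distrib card_eq_sum)
    also have "(\<Sum>e\<in>E - A. card (K e)) \<le> (\<Sum>e\<in>E - A. card (M e))" by (rule sum_mono) (rule part)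
    finally have "card F \<le> (\<Sum>e\<in>E. card (M e)) + card A"
      using sum.subset_diff[OF AE fin, of "\<lambda>e. card (M e)"] by simp
    then show ?thesis using cJ lower by linarith
  qed
  then show "(2 - 1) * card F < card (\<Union>F)" by simp
qed

end

section \<open>Lower bound\<close>

lemma t_min_pos:
  assumes "s \<le> d" "admissible r n d"
  shows "0 < t_min r n d s"
proof -
  obtain H where H: "dense_rgraph r n d H" using assms(2) unfolding admissible_def by blast
  obtain H' :: "nat hypergraph" where H': "rgraph r H'" "verts H' \<noteq> {}" "card (verts H') \<le> t_min r n d s"
    using t_min_attained[OF assms(1) H] by meson
  have "card (verts H') > 0" using H'(1,2) unfolding rgraph_def by (auto simp: card_gt_0_iff)
  then show ?thesis using H'(3) by linarith
qed

lemma admissible_pos: "admissible r n d \<Longrightarrow> n > 0"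
  unfolding admissible_def dense_rgraph_def rgraph_def by (auto simp: card_gt_0_iff)

text \<open>Bernoulli's inequality \<open>1 + n * x \<le> (1 + x)^n\<close>. It covers the cases
  where \<open>n\<close> or \<open>n * \<gamma>\<close> is bounded.\<close>

lemma Phi_le_n:
  assumes "x \<ge> 0"
  shows "Phi n x \<le> real n"
proof (cases "x = 0")
  case False
  then have x: "x > 0" using assms by simp
  have "1 + real n * x \<le> (1 + x) ^ n" using Bernoulli_inequality[of x n] x by simp
  then have "ln (1 + real n * x) \<le> ln ((1 + x) ^ n)"
    using x by (subst ln_le_cancel_iff) (auto intro: add_pos_nonneg)
  also have "\<dots> = n * ln (1 + x)" using x by (simp add: ln_realpow)
  finally show ?thesis using x unfolding Phi_def by (simp add: divide_le_eq)
qed (simp add: Phi_def)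

text \<open>An integer logarithm; the alternative \<open>g = 0\<close> absorbs
  \<open>z < 1\<close>.\<close>

lemma power_between:
  fixes y z :: real
  assumes "y > 1"
  obtains g where "g = 0 \<or> y ^ g \<le> z" "z < y ^ (g + 1)"
proof -
  obtain k where k: "z < y ^ k" using real_arch_pow[OF assms] by blast
  define j where "j = (LEAST k. z < y ^ k)"
  have j: "z < y ^ j" unfolding j_def using k by (rule LeastI)
  show ?thesis
  proof (cases j)
    case 0
    then have "z < y ^ (0 + 1)" using j assms by simp
    then show ?thesis using that[of 0] by blast
  next
    case (Suc g)
    then have "\<not> z < y ^ g" unfolding j_def by (intro not_less_Least) (simp add: j_def[symmetric])
    then show ?thesis using that[of g] j Suc by simp
  qed
qed

text \<open>The extremal example is a loose cycle: edge \<open>k\<close> is a block of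
  \<open>r - 1\<close> vertices plus the first vertex of the next block. Edges that span only their
  own blocks form a set closed under the cyclic successor, hence the whole cycle.\<close>

lemma t_min_loose_cycle:
  assumes r: "r \<ge> 3" and dvd: "(r - 1) dvd n" and adm: "admissible r n (c_crit r)"
  shows "t_min r n (c_crit r) (c_crit r) = n"
proof (rule antisym)
  show "t_min r n (c_crit r) (c_crit r) \<le> n" by (rule t_min_le_n) simp
  define s where "s = r - 1"
  have s: "s \<ge> 2" "r = Suc s" unfolding s_def using r by auto
  obtain m where "n = (r - 1) * m" using dvd by (rule dvdE)
  then have m: "n = m * s" unfolding s_def by (simp only: mult.commute)
  have n0: "n > 0" using adm by (rule admissible_pos)
  \<comment> \<open>For \<open>m = 1\<close> there are only \<open>r - 1\<close> vertices, hence no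
    edge, and admissibility fails.\<close>
  have m2: "m \<ge> 2"
  proof (rule ccontr)
    assume "\<not> ?thesis"
    then have "m = 1" using n0 m by (cases m) auto
    then have "n - 1 < r - 1" using m s by simp
    then have zero: "(n - 1) choose (r - 1) = 0" by (rule binomial_eq_0)
    have c: "c_crit r > 0" unfolding c_crit_def using r by simp
    have "r \<ge> 2" using r by simp
    then have "c_crit r \<le> real ((n - 1) choose (r - 1))"
      using admissible_iff[OF c, of r n] adm by blast
    then show False using c unfolding zero by simp
  qed
  define edge where "edge k = {k} \<times> {..<s} \<union> {(Suc k mod m, 0)}" for k
  have neq: "Suc k mod m \<noteq> k" if "k < m" for k
    using that m2 by (cases "Suc k = m") auto
  have inj: "inj_on edge {..<m}"
  proof (rule inj_onI)
    fix k k' assume "edge k = edge k'"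
    \<comment> \<open>Second coordinate 1 occurs only in the own block, as the borrowed vertex has
      second coordinate 0.\<close>
    moreover have "(k, 1) \<in> edge k" unfolding edge_def using s by simp
    ultimately have "(k, 1) \<in> edge k'" by simp
    then show "k = k'" unfolding edge_def by simp
  qed
  let ?E = "edge ` {..<m}" and ?V = "{..<m} \<times> {..<s}"
  have cE: "card ?E = m" using card_image[OF inj] by simp
  show "n \<le> t_min r n (c_crit r) (c_crit r)"
  proof (rule t_min_ge[where V = ?V and E = ?E])
    show "card ?V \<le> n" using m by (simp add: card_cartesian_product)
    show "?E \<subseteq> {e. e \<subseteq> ?V \<and> card e = r}"
    proof -
      have "edge k \<subseteq> ?V \<and> card (edge k) = r" if "k < m" for k
      proof
        show "edge k \<subseteq> ?V" unfolding edge_def using that s m2 by auto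
        show "card (edge k) = r" unfolding edge_def s(2)
          using neq[OF that] by (subst card_Un_disjoint) (auto simp: card_cartesian_product)
      qed
      then show ?thesis by auto
    qed
    show "c_crit r * real n \<le> real r * real (card ?E)"
      unfolding cE m c_crit_def s(2) using s(1) by simp
    fix F assume F: "F \<subseteq> ?E" "F \<noteq> {}" "card (\<Union>F) \<le> (r - 1) * card F"
    obtain K where K: "K \<subseteq> {..<m}" "F = edge ` K" using F(1) by (auto simp: subset_image_iff)
    have finK: "finite K" using K(1) finite_subset by blast
    have cF: "card F = card K" unfolding K(2) by (rule card_image[OF inj_on_subset[OF inj K(1)]])
    have sub: "K \<times> {..<s} \<subseteq> \<Union>F" unfolding K(2) edge_def by auto
    have finU: "finite (\<Union>F)" unfolding K(2) edge_def using finK by auto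
    have "card (\<Union>F) \<le> card (K \<times> {..<s})"
      using F(3) unfolding cF s_def by (simp add: card_cartesian_product mult.commute)
    then have eq: "K \<times> {..<s} = \<Union>F" by (rule card_seteq[OF finU sub])
    have closed: "Suc k mod m \<in> K" if "k \<in> K" for k
    proof -
      have "(Suc k mod m, 0) \<in> \<Union>F" unfolding K(2) edge_def using that by auto
      then show ?thesis unfolding eq[symmetric] by simp
    qed
    obtain k0 where k0: "k0 \<in> K" using F(2) K(2) by blast
    have all: "(k0 + j) mod m \<in> K" for j
    proof (induction j)
      case 0
      then show ?case using k0 K(1) by auto
    next
      case (Suc j)
      have "(k0 + Suc j) mod m = Suc ((k0 + j) mod m) mod m" by (simp add: mod_Suc_eq)
      then show ?case using closed[OF Suc.IH] by simp
    qed
    have "i \<in> K" if "i < m" for i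
    proof -
      have "k0 < m" using k0 K(1) by auto
      then have "(k0 + (m - k0 + i)) mod m = i" using that by simp
      then show ?thesis using all[of "m - k0 + i"] by simp
    qed
    then have "K = {..<m}" using K(1) by auto
    then show "n \<le> card (\<Union>F)" unfolding eq[symmetric] m by (simp add: card_cartesian_product)
  qed (use r n0 in auto)
qed

section \<open>Lower bound for \<open>\<gamma>\<close> bounded away from 0\<close>

lemma t_min_lower_large:
  fixes \<gamma>0 :: real
  assumes r: "r \<ge> 3" and \<gamma>0: "\<gamma>0 > 0"
  obtains C :: real where "C > 0"
    "\<And>n d \<gamma>. c_crit r \<le> d \<Longrightarrow> admissible r n d \<Longrightarrow> \<gamma> = (real r - 1) * d - real r \<Longrightarrow> \<gamma>0 \<le> \<gamma> \<Longrightarrow>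
      Phi n \<gamma> \<le> C * t_min r n d (c_crit r)"
proof -
  \<comment> \<open>\<open>A\<close> depends only on \<open>r\<close> and \<open>\<gamma>0\<close>.
    It makes the ball growth \<open>1 + r * D\<close> at most
    \<open>y = (1 + \<gamma>)^(A + 1)\<close>.\<close>
  obtain A where A: "1 + real r + real r ^ 2 < (1 + \<gamma>0) ^ A"
    using real_arch_pow[of "1 + \<gamma>0"] \<gamma>0 by auto
  define C where "C = 2 + real A + ln (2 * real r) / ln (1 + \<gamma>0)"
  have lr: "ln (2 * real r) / ln (1 + \<gamma>0) \<ge> 0" using r \<gamma>0 by simp
  have "C > 0" unfolding C_def using lr by simp
  moreover have "Phi n \<gamma> \<le> C * t_min r n d (c_crit r)"
    if d: "c_crit r \<le> d" and adm: "admissible r n d" and \<gamma>: "\<gamma> = (real r - 1) * d - real r" "\<gamma>0 \<le> \<gamma>"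
    for n d \<gamma>
  proof -
    have n0: "n > 0" using adm by (rule admissible_pos)
    have \<gamma>p: "\<gamma> > 0" using \<gamma>(2) \<gamma>0 by linarith
    have d0: "d \<ge> 0" by (rule order_trans[OF _ d]) (use r in \<open>simp add: c_crit_def\<close>)
    \<comment> \<open>Twice \<open>d\<close>, because the greedy construction guarantees only half
      of the degree sum \<open>n * D\<close>.\<close>
    define D where "D = nat \<lceil>2 * d\<rceil>"
    have D1: "2 * d \<le> D" unfolding D_def by linarith
    have D2: "D \<le> 2 * d + 1" unfolding D_def using d0 by linarith
    have "2 * d \<le> (real r - 1) * d" using r d0 by (intro mult_right_mono) auto
    then have D3: "real D \<le> \<gamma> + r + 1" using D2 \<gamma>(1) by linarith
    define y where "y = (1 + \<gamma>) ^ (A + 1)"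
    have "1 + real r * D \<le> 1 + real r * (\<gamma> + r + 1)" using D3 by (intro add_left_mono mult_left_mono) auto
    also have "\<dots> \<le> (1 + \<gamma>) * (1 + real r + real r ^ 2)"
      using \<gamma>p by (simp add: algebra_simps power2_eq_square)
    also have "\<dots> \<le> (1 + \<gamma>) * (1 + \<gamma>) ^ A"
    proof (rule mult_left_mono)
      have "(1 + \<gamma>0) ^ A \<le> (1 + \<gamma>) ^ A" using \<gamma>0 \<gamma>(2) by (intro power_mono) auto
      then show "1 + real r + real r ^ 2 \<le> (1 + \<gamma>) ^ A" using A by linarith
    qed (use \<gamma>p in simp)
    finally have Q: "1 + real r * D \<le> y" unfolding y_def by simp
    have "y > 1" unfolding y_def using \<gamma>p by (intro one_less_power) auto
    \<comment> \<open>The largest \<open>g\<close> with \<open>2 * r * y^g \<le> n\<close>, as the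
      greedy construction demands, or 0 if there is none; then positivity of \<open>t_min\<close>
      suffices.\<close>
    then obtain g where g: "g = 0 \<or> y ^ g \<le> n / (2 * r)" "n / (2 * r) < y ^ (g + 1)"
      by (rule power_between)
    have t: "g < t_min r n d (c_crit r)"
    proof (cases "g = 0")
      case True
      then show ?thesis using t_min_pos[OF d adm] by simp
    next
      case False
      have "real (2 * r * (1 + r * D) ^ g) = 2 * r * (1 + real r * D) ^ g" by simp
      also have "\<dots> \<le> 2 * r * y ^ g" using Q by (intro mult_left_mono power_mono) auto
      also have "\<dots> \<le> n" using g(1) False r by (simp add: field_simps)
      finally have N: "2 * r * (1 + r * D) ^ g \<le> n" by (simp only: of_nat_le_iff)
      have "r \<ge> 2" "g \<ge> 1" using r False by auto
      then obtain E where E: "E \<subseteq> {e. e \<subseteq> {..<n} \<and> card e = r}" "sparse r g E"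
          "n * D \<le> 2 * r * card E"
        using dense_sparse_exists[OF _ _ N] by blast
      have "real (n * D) \<le> real (2 * r * card E)" using E(3) by (simp only: of_nat_le_iff)
      moreover have "2 * d * n \<le> D * real n" using D1 by (intro mult_right_mono) auto
      ultimately have "d * n \<le> real r * card E" by (simp add: algebra_simps)
      then show ?thesis
        using sparse_less_t_min[OF \<open>r \<ge> 2\<close> _ _ n0 E(1) _ d E(2)] by simp
    qed
    have l: "ln (1 + \<gamma>) > 0" using \<gamma>p by simp
    have "n \<le> 2 * r * y ^ (g + 1)" using g(2) r by (simp add: field_simps)
    then have "ln n \<le> ln (2 * r * y ^ (g + 1))"
      using n0 r \<open>y > 1\<close> by (subst ln_le_cancel_iff) auto
    also have "\<dots> = ln (2 * r) + (g + 1) * ((A + 1) * ln (1 + \<gamma>))"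
    proof -
      have "ln (y ^ (g + 1)) = (g + 1) * ln y" using \<open>y > 1\<close> by (subst ln_realpow) auto
      moreover have "ln y = (A + 1) * ln (1 + \<gamma>)" unfolding y_def using \<gamma>p by (subst ln_realpow) auto
      moreover have "ln (2 * r * y ^ (g + 1)) = ln (2 * r) + ln (y ^ (g + 1))"
        using r \<open>y > 1\<close> by (subst ln_mult) auto
      ultimately show ?thesis by simp
    qed
    finally have ln_n: "ln n \<le> ln (2 * r) + (g + 1) * ((A + 1) * ln (1 + \<gamma>))" .
    have "1 + n * \<gamma> \<le> n * (1 + \<gamma>)" using n0 by (simp add: algebra_simps)
    then have "ln (1 + n * \<gamma>) \<le> ln (n * (1 + \<gamma>))"
      using \<gamma>p n0 by (subst ln_le_cancel_iff) (auto intro: add_pos_nonneg)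
    also have "\<dots> = ln n + ln (1 + \<gamma>)" using n0 \<gamma>p by (simp add: ln_mult)
    finally have "ln (1 + n * \<gamma>) \<le> ln (2 * r) + ((g + 1) * (A + 1) + 1) * ln (1 + \<gamma>)"
      using ln_n by (simp add: algebra_simps)
    then have "Phi n \<gamma> \<le> (ln (2 * r) + ((g + 1) * (A + 1) + 1) * ln (1 + \<gamma>)) / ln (1 + \<gamma>)"
      unfolding Phi_def using \<gamma>p l by (simp add: divide_right_mono)
    also have "\<dots> = ln (2 * r) / ln (1 + \<gamma>) + ((g + 1) * (A + 1) + 1)"
      using l by (simp add: add_divide_distrib)
    also have "ln (2 * r) / ln (1 + \<gamma>) \<le> ln (2 * r) / ln (1 + \<gamma>0)"
      using r \<gamma>0 \<gamma>(2) l by (intro divide_left_mono) auto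
    also have "ln (2 * r) / ln (1 + \<gamma>0) + ((g + 1) * (A + 1) + 1) \<le> C * (g + 1)"
    proof -
      have "ln (2 * real r) / ln (1 + \<gamma>0) * 1 \<le> ln (2 * real r) / ln (1 + \<gamma>0) * (g + 1)"
        using lr by (intro mult_left_mono) auto
      then show ?thesis unfolding C_def by (simp add: algebra_simps)
    qed
    also have "\<dots> \<le> C * t_min r n d (c_crit r)"
      using t \<open>C > 0\<close> by (intro mult_left_mono) (auto simp: of_nat_le_iff[symmetric] simp del: of_nat_le_iff)
    finally show ?thesis by simp
  qed
  ultimately show ?thesis by (rule that)
qed

section \<open>Lower bound for small \<open>\<gamma>\<close>\<close>

text \<open>The excess \<open>(r - 1) e - n\<close> of the base graph (\<open>2 N\<close> edges on \<open>N\<close> vertices) survives both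
  subdivision and padding.\<close>

lemma sparse_subdivided_exists:
  assumes r: "r \<ge> 2" and g: "g \<ge> 1" "4 * 17 ^ g \<le> N" and l: "l \<ge> 2"
    and m: "(r - 1) * m \<le> n + N" "2 * N * l \<le> m"
  obtains V :: "((nat + nat set \<times> nat) + (nat + nat set \<times> nat) set \<times> nat) set" and E
  where "finite V" "card V \<le> n" "E \<subseteq> {e. e \<subseteq> V \<and> card e = r}" "card E = m"
    "sparse r (l * g) E"
proof -
  \<comment> \<open>Degree bound 8 gives growth \<open>17 = 1 + 2 * 8\<close> and at least
    \<open>8 * N / 4 = 2 * N\<close> edges.\<close>
  have "2 * 2 * (1 + 2 * 8) ^ g \<le> N" using g(2) by simp
  then obtain E0 where E0: "E0 \<subseteq> {e. e \<subseteq> {..<N} \<and> card e = 2}" "sparse 2 g E0"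
      "N * 8 \<le> 2 * 2 * card E0"
    by (rule dense_sparse_exists[OF order_refl g(1)])
  have "2 * N \<le> card E0" using E0(3) by simp
  then obtain E1 where E1: "E1 \<subseteq> E0" "card E1 = 2 * N" "finite E1"
    by (rule obtain_subset_with_card_n)
  have N0: "N > 0"
  proof -
    have "(0::nat) < 4 * 17 ^ g" by simp
    then show ?thesis using g(2) by linarith
  qed
  then have "E1 \<noteq> {}" using E1(2) by auto
  then obtain e0 where e0: "e0 \<in> E1" by blast
  \<comment> \<open>The edge \<open>e0\<close> takes up the slack so that the lengths add up to
    exactly \<open>m\<close>; \<open>2 * N * l \<le> m\<close> makes its length at least
    \<open>l\<close>.\<close>
  define L where "L e = (if e = e0 then m - (2 * N - 1) * l else l)" for e
  have m': "m = (2 * N - 1) * l + (m - (2 * N - 1) * l)" "l \<le> m - (2 * N - 1) * l"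
  proof -
    have "2 * N * l = (2 * N - 1) * l + l" using N0 by (cases N) auto
    then show "m = (2 * N - 1) * l + (m - (2 * N - 1) * l)" "l \<le> m - (2 * N - 1) * l"
      using m(2) by linarith+
  qed
  have Ll: "l \<le> L e" if "e \<in> E1" for e unfolding L_def using m'(2) by simp
  have two: "card e = 2" if "e \<in> E1" for e using that E1(1) E0(1) by auto
  have L2: "2 \<le> L e" if "e \<in> E1" for e using Ll[OF that] l by linarith
  have sumL: "(\<Sum>e\<in>E1. L e) = m"
  proof -
    have "(\<Sum>e\<in>E1. L e) = L e0 + (\<Sum>e\<in>E1 - {e0}. L e)" by (rule sum.remove[OF E1(3) e0])
    also have "(\<Sum>e\<in>E1 - {e0}. L e) = (\<Sum>e\<in>E1 - {e0}. l)"
      by (rule sum.cong) (auto simp: L_def)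
    also have "\<dots> = (2 * N - 1) * l" using E1 e0 by simp
    finally show ?thesis using m'(1) unfolding L_def by simp
  qed
  let ?I = "Sigma E1 (\<lambda>e. {..<L e})"
  define E2 where "E2 = link L ` ?I"
  define V2 where "V2 = Inl ` {..<N} \<union> Inr ` Sigma E1 (\<lambda>e. {1..<L e})"
  define V where "V = Inl ` V2 \<union> Inr ` (E2 \<times> {..<r - 2})"
  have finI: "finite ?I" using E1(3) by auto
  have fin2: "finite E2" unfolding E2_def using finI by simp
  have finV2: "finite V2" unfolding V2_def using E1(3) by auto
  have c2: "card E2 = m"
  proof -
    have "card E2 = card ?I"
      unfolding E2_def by (rule card_image[OF inj_on_link[where E = E1 and L = L, OF two L2 E1(3)]])
    then show ?thesis using E1(3) sumL by (simp add: card_SigmaI)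
  qed
  have card_e: "card e = 2" if "e \<in> E2" for e
    using that card_link[where E = E1 and L = L, OF two L2 E1(3)] unfolding E2_def by blast
  have finite_e: "finite e" if "e \<in> E2" for e
    by (rule card_ge_0_finite) (simp only: card_e[OF that] zero_less_numeral)
  have "\<Union>E1 \<subseteq> {..<N}" using E1(1) E0(1) by auto
  then have sub2: "e \<subseteq> V2" if "e \<in> E2" for e
    using that link_subset[where E = E1 and L = L, OF two L2 E1(3), of _ "{..<N}"] unfolding E2_def V2_def by blast
  have cV2: "card V2 + N = m"
  proof -
    have "card V2 = N + (\<Sum>e\<in>E1. L e - 1)"
      unfolding V2_def using E1(3)
      by (subst card_Un_disjoint) (auto simp: card_image card_SigmaI)
    moreover have "(\<Sum>e\<in>E1. L e) = (\<Sum>e\<in>E1. (L e - 1) + 1)"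
    proof (rule sum.cong[OF refl])
      fix e assume "e \<in> E1"
      then show "L e = (L e - 1) + 1" using L2[of e] by simp
    qed
    ultimately show ?thesis using sumL E1(2) unfolding sum.distrib by simp
  qed
  have "card V = card V2 + m * (r - 2)"
    unfolding V_def using finV2 fin2 c2
    by (subst card_Un_disjoint) (auto simp: card_image card_cartesian_product)
  moreover have "(r - 1) * m = m + m * (r - 2)"
  proof -
    have "r - 1 = Suc (r - 2)" using r by simp
    then show ?thesis by simp
  qed
  ultimately have cV: "card V \<le> n" using cV2 m(1) by linarith
  have finV: "finite V" unfolding V_def using finV2 fin2 by simp
  have "pad r e \<subseteq> V \<and> card (pad r e) = r" if "e \<in> E2" for e
  proof
    show "pad r e \<subseteq> V" using sub2[OF that] that unfolding pad_def V_def by auto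
    show "card (pad r e) = r" using card_pad[OF finite_e[OF that], of r] card_e[OF that] r by simp
  qed
  then have sub: "pad r ` E2 \<subseteq> {e. e \<subseteq> V \<and> card e = r}" by auto
  have "card (pad r ` E2) = m"
    using card_image[OF inj_on_subset[OF inj_pad subset_UNIV], of r E2] c2 by simp
  moreover have "sparse 2 (l * g) E2"
    unfolding E2_def
    by (rule sparse_subdivide[where E = E1 and L = L, OF two L2 E1(3) sparse_subset[OF E0(2) E1(1)] Ll]) (use l in auto)
  then have "sparse r (l * g) (pad r ` E2)" by (intro sparse_pad r fin2 finite_e)
  ultimately show ?thesis using that[OF finV cV sub] by blast
qed

lemma ln_one_plus_ge_half:
  fixes x :: real
  assumes "0 \<le> x" "x \<le> 1 / 2"
  shows "x / 2 \<le> ln (1 + x)"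
proof -
  have "x * x \<le> x * (1 / 2)" using assms by (intro mult_left_mono) auto
  moreover have "x - x ^ 2 \<le> ln (1 + x)" using ln_one_plus_pos_lower_bound[of x] assms by simp
  ultimately show ?thesis by (simp add: power2_eq_square)
qed

text \<open>With \<open>N\<close> about \<open>\<gamma> * n + K\<close> base vertices, subdivision
  length \<open>l\<close> about \<open>n / (2 * N * r)\<close> and \<open>g\<close> of order
  \<open>ln N\<close>, the construction is sparse up to \<open>l * g\<close> edges, and this product
  dominates \<open>Phi n \<gamma>\<close> up to a constant.\<close>

lemma t_min_lower_small:
  assumes r: "r \<ge> 3"
  obtains C :: real where "C > 0"
    "\<And>n d \<gamma>. c_crit r \<le> d \<Longrightarrow> admissible r n d \<Longrightarrow> \<gamma> = (real r - 1) * d - real r \<Longrightarrow> \<gamma> \<le> 1 / (8 * real r) \<Longrightarrow>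
      Phi n \<gamma> \<le> C * t_min r n d (c_crit r)"
proof -
  \<comment> \<open>\<open>68 = 4 * 17\<close> forces \<open>g \<ge> 1\<close>; the summand
    \<open>r\<close> pays for the rounding in \<open>m\<close>.\<close>
  define K where "K = 68 + r"
  \<comment> \<open>\<open>280 = 4 * 2 * 35\<close>: 4 from \<open>n \<le> 4 * N * r * l\<close>, 2
    from \<open>\<gamma> / 2 \<le> ln (1 + \<gamma>)\<close>, 35 from
    \<open>ln (1 + n * \<gamma>) \<le> 35 * g\<close>.\<close>
  define C where "C = 280 * real r * (K + 2)"
  have "C > 0" unfolding C_def using r by simp
  moreover have "Phi n \<gamma> \<le> C * t_min r n d (c_crit r)"
    if d: "c_crit r \<le> d" and adm: "admissible r n d" and \<gamma>: "\<gamma> = (real r - 1) * d - real r"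
      "\<gamma> \<le> 1 / (8 * real r)" for n d \<gamma>
  proof -
    have n0: "n > 0" using adm by (rule admissible_pos)
    have r1: "real r - 1 > 0" using r by simp
    have "real r \<le> (real r - 1) * d" using d r1 unfolding c_crit_def by (simp add: field_simps)
    then have \<gamma>0: "\<gamma> \<ge> 0" using \<gamma>(1) by simp
    have r\<gamma>: "8 * r * \<gamma> \<le> 1" using \<gamma>(2) r by (simp add: field_simps)
    have t1: "1 \<le> real (t_min r n d (c_crit r))" using t_min_pos[OF d adm] by simp
    show ?thesis
    proof (cases "n < 8 * r * (K + 1)")
      case True
      have "Phi n \<gamma> \<le> real n" by (rule Phi_le_n[OF \<gamma>0])
      also have "\<dots> \<le> real (8 * r * (K + 1))" using True by (simp only: of_nat_le_iff less_imp_le)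
      also have "\<dots> \<le> C"
      proof -
        have "8 * r * (K + 1) \<le> 280 * r * (K + 2)" by (intro mult_le_mono) auto
        then have "real (8 * r * (K + 1)) \<le> real (280 * r * (K + 2))" by (simp only: of_nat_le_iff)
        also have "real (280 * r * (K + 2)) = C" unfolding C_def by (simp add: algebra_simps)
        finally show ?thesis .
      qed
      also have "C * 1 \<le> C * t_min r n d (c_crit r)" using t1 \<open>C > 0\<close> by (intro mult_left_mono) auto
      finally show ?thesis by simp
    next
      case False
      define N where "N = nat \<lceil>\<gamma> * n\<rceil> + K"
      have gn: "\<gamma> * n \<ge> 0" using \<gamma>0 by simp
      have N1: "\<gamma> * n + K \<le> N" unfolding N_def using gn by linarith
      have N2: "N \<le> \<gamma> * n + K + 1" unfolding N_def using gn by linarith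
      have N68: "68 \<le> N" unfolding N_def K_def by simp
      have "(1::real) < 17" by simp
      then obtain g where g: "g = 0 \<or> (17::real) ^ g \<le> N / 4" "N / 4 < (17::real) ^ (g + 1)"
        by (rule power_between)
      have g1: "g \<ge> 1"
      proof (rule ccontr)
        assume "\<not> ?thesis"
        then have "g = 0" by simp
        then have "N / 4 < (17::real)" using g(2) by simp
        then show False using N68 by simp
      qed
      have "real (4 * 17 ^ g) \<le> real N" using g(1) g1 by simp
      then have gN: "4 * 17 ^ g \<le> N" by (simp only: of_nat_le_iff)
      define l where "l = n div (2 * N * r)"
      have q0: "2 * N * r > 0" using N68 r by simp
      \<comment> \<open>Half of \<open>n\<close> pays for \<open>\<gamma> * n\<close>, by
        \<open>8 * r * \<gamma> \<le> 1\<close>, the other half for \<open>K + 1\<close>. This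
        yields \<open>l \<ge> 2\<close>.\<close>
      have "4 * N * r \<le> n"
      proof -
        have "4 * real r * N \<le> 4 * real r * (\<gamma> * n + K + 1)" using N2 by (intro mult_left_mono) auto
        also have "\<dots> = (8 * r * \<gamma>) * n / 2 + 4 * real r * (K + 1)" by (simp add: algebra_simps)
        also have "(8 * r * \<gamma>) * n / 2 \<le> n / 2" using mult_right_mono[OF r\<gamma>, of n] by (simp add: ac_simps)
        also have "4 * real r * (K + 1) \<le> n / 2"
        proof -
          have "real (8 * r * (K + 1)) \<le> real n" using False by (simp only: of_nat_le_iff not_less)
          then show ?thesis by (simp add: algebra_simps)
        qed
        finally have "real (4 * N * r) \<le> real n" by (simp add: mult.commute mult.left_commute)
        then show ?thesis by (simp only: of_nat_le_iff)
      qed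
      then have l2: "l \<ge> 2" unfolding l_def using q0 by (simp add: less_eq_div_iff_mult_less_eq)
      \<comment> \<open>The construction with \<open>m\<close> edges has
        \<open>(r - 1) * m - N\<close> vertices, so this is the largest \<open>m\<close> that fits
        into \<open>n\<close>.\<close>
      define m where "m = (n + N) div (r - 1)"
      have m1: "(r - 1) * m \<le> n + N" unfolding m_def by simp
      have "r - 1 > 0" using r by simp
      then have m2: "n + N < (r - 1) * m + (r - 1)"
        using dividend_less_times_div[of "r - 1" "n + N"] unfolding m_def by simp
      have "l * (2 * N * r) \<le> n" unfolding l_def by simp
      then have "2 * N * l * (r - 1) \<le> n + N"
      proof -
        have "2 * N * l * (r - 1) \<le> 2 * N * l * r" by (intro mult_le_mono) auto
        also have "\<dots> = l * (2 * N * r)" by simp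
        finally show ?thesis using \<open>l * (2 * N * r) \<le> n\<close> by linarith
      qed
      then have m3: "2 * N * l \<le> m" unfolding m_def using r by (simp add: less_eq_div_iff_mult_less_eq)
      have r2: "r \<ge> 2" using r by simp
      obtain V :: "((nat + nat set \<times> nat) + (nat + nat set \<times> nat) set \<times> nat) set" and E
        where VE: "finite V" "card V \<le> n" "E \<subseteq> {e. e \<subseteq> V \<and> card e = r}" "card E = m"
          "sparse r (l * g) E"
        by (rule sparse_subdivided_exists[OF r2 g1 gN l2 m1 m3])
      have dense: "d * n \<le> real r * card E"
      proof -
        have "real (n + N) < real ((r - 1) * m + (r - 1))" using m2 by (simp only: of_nat_less_iff)
        then have "real n + N < (real r - 1) * m + r - 1" using r by (simp add: of_nat_diff)
        then have ex: "real n + \<gamma> * n \<le> (real r - 1) * m" using N1 unfolding K_def by simp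
        have "(real r - 1) * (d * n) = (\<gamma> + r) * n" unfolding \<gamma>(1) by (simp add: algebra_simps)
        also have "\<dots> = r * real n + 1 * (\<gamma> * n)" by (simp add: algebra_simps)
        also have "\<dots> \<le> r * real n + real r * (\<gamma> * n)"
          using gn r by (intro add_left_mono mult_right_mono) auto
        also have "\<dots> = r * (real n + \<gamma> * n)" by (simp add: algebra_simps)
        also have "\<dots> \<le> r * ((real r - 1) * m)" using ex by (intro mult_left_mono) auto
        also have "\<dots> = (real r - 1) * (r * m)" by (simp add: algebra_simps)
        finally have "d * n \<le> real r * m" using r1 by simp
        then show ?thesis using VE(4) by simp
      qed
      have t: "l * g < t_min r n d (c_crit r)"
        by (rule sparse_less_t_min[OF r2 VE(1,2) n0 VE(3) dense d VE(5)])
      have "n < (l + 1) * (2 * N * r)"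
        unfolding l_def using dividend_less_div_times[OF q0, of n] by simp
      also have "\<dots> \<le> (2 * l) * (2 * N * r)" using l2 by (intro mult_le_mono1) simp
      finally have "n \<le> 4 * N * r * l" by (simp add: ac_simps)
      then have "real n \<le> real (4 * N * r * l)" by (simp only: of_nat_le_iff)
      then have n_le: "real n \<le> (4 * real r * l) * N" by (simp add: ac_simps)
      have "Phi n \<gamma> \<le> C * (real l * g)"
      \<comment> \<open>If \<open>n * \<gamma> \<ge> 1\<close>, then \<open>g\<close> supplies the
        logarithm and \<open>l\<close> the factor \<open>1 / \<gamma>\<close>. Otherwise
        \<open>N\<close> is bounded and \<open>l\<close> alone is of order \<open>n\<close>.\<close>
      proof (cases "n * \<gamma> \<ge> 1")
        case True
        have \<gamma>p: "\<gamma> > 0" using True \<gamma>0 by (cases "\<gamma> = 0") auto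
        have "1 + n * \<gamma> \<le> N" using N1 unfolding K_def by (simp add: mult.commute)
        also have "\<dots> \<le> 4 * 17 ^ (g + 1)" using g(2) by simp
        finally have "ln (1 + n * \<gamma>) \<le> ln (4 * 17 ^ (g + 1))"
          using True by (subst ln_le_cancel_iff) auto
        also have "\<dots> = ln 4 + ln (17 ^ (g + 1))" by (rule ln_mult_pos) auto
        also have "\<dots> = ln 4 + (g + 1) * ln 17" by (subst ln_realpow) auto
        also have "\<dots> \<le> 3 + real (g + 1) * 16"
          using ln_le_minus_one[of "4::real"] ln_le_minus_one[of "17::real"]
          by (intro add_mono mult_left_mono) auto
        also have "\<dots> \<le> 35 * real g" using g1 by simp
        finally have lnn: "ln (1 + n * \<gamma>) \<le> 35 * real g" .
        have "1 / (8 * real r) \<le> 1 / 2" using r by (simp add: field_simps)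
        then have half: "\<gamma> / 2 \<le> ln (1 + \<gamma>)" using \<gamma>0 \<gamma>(2) by (intro ln_one_plus_ge_half) auto
        have "Phi n \<gamma> = ln (1 + n * \<gamma>) / ln (1 + \<gamma>)" unfolding Phi_def using \<gamma>p by simp
        also have "\<dots> \<le> (35 * real g) / (\<gamma> / 2)"
          by (rule frac_le[OF _ lnn _ half]) (use \<gamma>p in auto)
        finally have P: "Phi n \<gamma> \<le> 70 * real g / \<gamma>" by (simp add: field_simps)
        have "N \<le> n * \<gamma> + (real K + 1) * 1" using N2 by (simp add: mult.commute)
        also have "\<dots> \<le> n * \<gamma> + (real K + 1) * (n * \<gamma>)"
          using True by (intro add_left_mono mult_left_mono) auto
        also have "\<dots> = (real K + 2) * (n * \<gamma>)" by (simp add: algebra_simps)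
        finally have "(4 * real r * l) * N \<le> (4 * real r * l) * ((real K + 2) * (n * \<gamma>))"
          by (rule mult_left_mono) simp
        then have "real n * 1 \<le> (4 * real r * l) * ((real K + 2) * (n * \<gamma>))"
          using n_le by linarith
        then have "real n * 1 \<le> real n * ((4 * real r * l) * (real K + 2) * \<gamma>)"
          by (simp only: ac_simps)
        then have "1 \<le> (4 * real r * l) * (real K + 2) * \<gamma>" using n0 by (simp only: mult_le_cancel_left_pos of_nat_0_less_iff)
        then have "70 * real g * 1 \<le> 70 * real g * ((4 * real r * l) * (real K + 2) * \<gamma>)"
          by (intro mult_left_mono) auto
        also have "\<dots> = C * (real l * g) * \<gamma>" unfolding C_def by simp
        finally have "70 * real g / \<gamma> \<le> C * (real l * g)" using \<gamma>p by (simp add: divide_le_eq)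
        then show ?thesis using P by linarith
      next
        case False
        have "Phi n \<gamma> \<le> real n" by (rule Phi_le_n[OF \<gamma>0])
        also have "\<dots> \<le> (4 * real r * l) * N" by (rule n_le)
        also have "\<dots> \<le> (4 * real r * l) * (real K + 2)"
          using False N2 by (intro mult_left_mono) (auto simp: mult.commute)
        also have "\<dots> = (4 * real r * l * (real K + 2)) * 1" by simp
        also have "\<dots> \<le> (4 * real r * l * (real K + 2)) * (70 * real g)"
          using g1 by (intro mult_left_mono) auto
        also have "\<dots> = C * (real l * g)" unfolding C_def by simp
        finally show ?thesis .
      qed
      also have "\<dots> = C * real (l * g)" by simp
      also have "\<dots> \<le> C * t_min r n d (c_crit r)"
        using t \<open>C > 0\<close> by (intro mult_left_mono) (auto simp del: of_nat_mult)
      finally show ?thesis .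
    qed
  qed
  ultimately show ?thesis by (rule that)
qed

section \<open>Upper bound in terms of \<open>Phi\<close>, and the theorem\<close>

lemma t_min_upper_Phi:
  assumes r: "r \<ge> 2" and d: "c_crit r \<le> d" and \<gamma>: "\<gamma> = (real r - 1) * d - real r"
  shows "real (t_min r n d (c_crit r)) \<le> 2 * real r ^ 2 * Phi n \<gamma>"
proof -
  have r1: "real r - 1 > 0" using r by simp
  have "real r \<le> (real r - 1) * d" using d r1 unfolding c_crit_def by (simp add: field_simps)
  then have \<gamma>0: "\<gamma> \<ge> 0" using \<gamma> by simp
  show ?thesis
  proof (cases "\<gamma> = 0")
    case True
    have "real (t_min r n d (c_crit r)) \<le> 1 * real n" using t_min_le_n[OF d] by simp
    also have "\<dots> \<le> 2 * real r ^ 2 * real n"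
    proof (rule mult_right_mono)
      have "1 \<le> real r ^ 2" using r by (intro one_le_power) simp
      then show "1 \<le> 2 * real r ^ 2" by linarith
    qed simp
    finally show ?thesis unfolding Phi_def using True by simp
  next
    case False
    then have \<gamma>p: "\<gamma> > 0" using \<gamma>0 by simp
    define x where "x = (real r - 1) * d / r - 1"
    have x: "x = \<gamma> / r" unfolding x_def \<gamma> using r by (simp add: field_simps)
    have xp: "x > 0" unfolding x using \<gamma>p r by simp
    \<comment> \<open>Passing from \<open>x = \<gamma> / r\<close> to \<open>\<gamma>\<close> by
      Bernoulli's inequality costs a factor \<open>r\<close>.\<close>
    have "1 + \<gamma> \<le> (1 + x) ^ r" using Bernoulli_inequality[of x r] xp r unfolding x by simp
    then have "ln (1 + \<gamma>) \<le> ln ((1 + x) ^ r)"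
      using \<gamma>p xp by (subst ln_le_cancel_iff) auto
    then have den: "ln (1 + \<gamma>) / r \<le> ln (1 + x)"
      using r xp by (simp add: ln_realpow field_simps)
    have "x \<le> \<gamma>" unfolding x using \<gamma>p r by (simp add: field_simps)
    then have "1 + n * x \<le> 1 + n * \<gamma>" by (simp add: mult_left_mono)
    then have num: "ln (1 + n * x) \<le> ln (1 + n * \<gamma>)"
      using xp \<gamma>p by (subst ln_le_cancel_iff) (auto intro: add_pos_nonneg)
    have num0: "0 \<le> ln (1 + n * \<gamma>)" using \<gamma>p by simp
    have "real (t_min r n d (c_crit r)) \<le> 2 * real (r - 1) * (ln (1 + n * x) / ln (1 + x))"
      by (rule t_min_upper[OF r d x_def xp])
    also have "\<dots> \<le> 2 * real (r - 1) * (ln (1 + n * \<gamma>) / (ln (1 + \<gamma>) / r))"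
      by (intro mult_left_mono frac_le[OF num0 num _ den]) (use \<gamma>p r in auto)
    also have "\<dots> = 2 * real (r - 1) * r * Phi n \<gamma>" unfolding Phi_def using False by simp
    also have "\<dots> \<le> 2 * real r * r * Phi n \<gamma>"
      unfolding Phi_def using num0 \<gamma>p r by (intro mult_right_mono) auto
    finally show ?thesis by (simp add: power2_eq_square)
  qed
qed

theorem theorem8:
  fixes r :: nat
  assumes "r \<ge> 3"
  shows "(\<exists>b B :: real. b > 0 \<and> B > 0 \<and>
            (\<forall>(n :: nat) (d :: real). c_crit r \<le> d \<and> admissible r n d \<longrightarrow>
               (let \<gamma> = (real r - 1) * d - real r in
                  b * Phi n \<gamma> \<le> real (t_min r n d (c_crit r)) \<and>
                  real (t_min r n d (c_crit r)) \<le> B * Phi n \<gamma>))) \<and>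
         (\<forall>n :: nat. (r - 1) dvd n \<and> admissible r n (c_crit r) \<longrightarrow>
            t_min r n (c_crit r) (c_crit r) = n)"
proof
  \<comment> \<open>The two lower bounds meet at the threshold \<open>1 / (8 * r)\<close>; the sum
    of their constants serves both ranges.\<close>
  have \<gamma>0: "1 / (8 * real r) > 0" using assms by simp
  obtain C1 :: real where C1: "C1 > 0"
    "\<And>n d \<gamma>. c_crit r \<le> d \<Longrightarrow> admissible r n d \<Longrightarrow> \<gamma> = (real r - 1) * d - real r \<Longrightarrow>
      1 / (8 * real r) \<le> \<gamma> \<Longrightarrow> Phi n \<gamma> \<le> C1 * t_min r n d (c_crit r)"
    using t_min_lower_large[OF assms \<gamma>0] by metis
  obtain C2 :: real where C2: "C2 > 0"
    "\<And>n d \<gamma>. c_crit r \<le> d \<Longrightarrow> admissible r n d \<Longrightarrow> \<gamma> = (real r - 1) * d - real r \<Longrightarrow>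
      \<gamma> \<le> 1 / (8 * real r) \<Longrightarrow> Phi n \<gamma> \<le> C2 * t_min r n d (c_crit r)"
    using t_min_lower_small[OF assms] by metis
  define b where "b = 1 / (C1 + C2)"
  have "b > 0" unfolding b_def using C1(1) C2(1) by simp
  moreover have "2 * real r ^ 2 > 0" using assms by simp
  moreover have "b * Phi n \<gamma> \<le> t_min r n d (c_crit r)"
    if "c_crit r \<le> d" "admissible r n d" "\<gamma> = (real r - 1) * d - real r" for n d \<gamma>
  proof -
    let ?t = "real (t_min r n d (c_crit r))"
    have "Phi n \<gamma> \<le> C1 * ?t \<or> Phi n \<gamma> \<le> C2 * ?t" using C1(2)[OF that] C2(2)[OF that] by linarith
    moreover have "0 \<le> C1 * ?t" "0 \<le> C2 * ?t" using C1(1) C2(1) by simp_all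
    ultimately have "Phi n \<gamma> \<le> (C1 + C2) * ?t" unfolding distrib_right by linarith
    then show ?thesis unfolding b_def using C1(1) C2(1) by (simp add: field_simps)
  qed
  moreover have "r \<ge> 2" using assms by simp
  ultimately show "\<exists>b B :: real. b > 0 \<and> B > 0 \<and>
      (\<forall>(n :: nat) (d :: real). c_crit r \<le> d \<and> admissible r n d \<longrightarrow>
        (let \<gamma> = (real r - 1) * d - real r in
          b * Phi n \<gamma> \<le> real (t_min r n d (c_crit r)) \<and>
          real (t_min r n d (c_crit r)) \<le> B * Phi n \<gamma>))"
    unfolding Let_def
    by (intro exI[of _ b] exI[of _ "2 * real r ^ 2"]) (use t_min_upper_Phi in auto)
  show "\<forall>n. (r - 1) dvd n \<and> admissible r n (c_crit r) \<longrightarrow> t_min r n (c_crit r) (c_crit r) = n"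
    using t_min_loose_cycle[OF assms] by blast
qed

end
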